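(* Let $\Gamma_k(x,\varepsilon)$, $k=0,1,2,\dots$, be defined by $\Gamma_0(x,\varepsilon)=\gamma(x)$ and $$g(x,\Gamma_{k+1}(x,\varepsilon))=\varepsilon\,\nabla_x\Gamma_k(x,\varepsilon)\,f(x,\Gamma_k(x,\varepsilon)),\qquad k=0,1,2,\dots.$$ Then, as $\varepsilon\to0$, $$|\Gamma_1(x,\varepsilon)-\gamma(x)-\varepsilon\gamma_1(x)|=\mathcal O(\varepsilon^2),$$ $$|\nabla_x\Gamma_1(x,\varepsilon)-\nabla\gamma(x)-\varepsilon\nabla\gamma_1(x)|=\mathcal O(\varepsilon^2),$$ $$|\Gamma_2(x,\varepsilon)-\gamma(x)-\varepsilon\gamma_1(x)-\varepsilon^2\gamma_2(x)|=\mathcal O(\varepsilon^3),$$ where the bounds are uniform in $x\in\mathbb R^{n_x}$. In other words, $\|\Gamma_1(\cdot,\varepsilon)-\gamma-\varepsilon\gamma_1\|_{1,\infty}=\mathcal O(\varepsilon^2)$ and $\|\Gamma_2(\cdot,\varepsilon)-\gamma-\varepsilon\gamma_1-\varepsilon^2\gamma_2\|_{0,\infty}=\mathcal O(\varepsilon^3)$.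
   Context: Setting: $n_x,n_y\ge1$ are integers, $0<\varepsilon\le\varepsilon_0\ll1$, and $f:\mathbb R^{n_x}\times\mathbb R^{n_y}\to\mathbb R^{n_x}$, $g:\mathbb R^{n_x}\times\mathbb R^{n_y}\to\mathbb R^{n_y}$ are sufficiently smooth functions such that, for some integer $K\ge1$, $f\in W^{K,\infty}$ and $\nabla g\in W^{K,\infty}$, where $\|\xi\|_{k,\infty}=\max_{0\le j\le k}\|\nabla^j\xi\|_{L^\infty}$ is the $W^{k,\infty}$ norm. For each $x\in\mathbb R^{n_x}$ there is $\gamma(x)\in\mathbb R^{n_y}$ with $g(x,\gamma(x))=0$, and there is $\beta>0$ with $\langle g(x,y)-g(x,\tilde y),y-\tilde y\rangle\le-\beta|y-\tilde y|^2$ for all $x\in\mathbb R^{n_x}$, $y,\tilde y\in\mathbb R^{n_y}$. Hence for each $x$ the map $g(x,\cdot)$ is a bijection of $\mathbb R^{n_y}$, so $\gamma$ is unique and the iteration defining $\Gamma_{k+1}$ has a unique solution. Definitions: Put $F(x)=f(x,\gamma(x))$, $F_y(x)=\left[\frac{\partial f^i}{\partial y^j}(x,\gamma(x))\right]_{i,j}$, $G_y(x)=\left[\frac{\partial g^i}{\partial y^j}(x,\gamma(x))\right]_{i,j}$ (an invertible matrix), $G_{yy}^{i,j,k}(x)=\frac{\partial^2g^i}{\partial y^j\partial y^k}(x,\gamma(x))$, and $$\gamma_1(x)=G_y(x)^{-1}\nabla\gamma(x)F(x),$$ $$\gamma_2(x)=G_y(x)^{-1}\Big(\nabla\gamma(x)F_y(x)\gamma_1(x)+\nabla\gamma_1(x)F(x)-\tfrac12\Big[\sum_{j,k=1}^{n_y}G_{yy}^{i,j,k}(x)\gamma_1^j(x)\gamma_1^k(x)\Big]_{i=1}^{n_y}\Big).$$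 Here $\nabla\gamma$, $\nabla\gamma_1$, $\nabla_x\Gamma_k$ are Jacobian matrices in $x$ ($n_y\times n_x$) and superscripts denote components.
   Formalization: The integer K is taken to be at least 2 instead of at least 1, since with K = 1 the uniform bound on Γ_2 can fail: for g = x − y and a smooth f with bounded first but unbounded second derivatives, the error is only of order ε². *)

theory Defs
  imports "HOL-Analysis.Analysis" "HOL-Probability.Essential_Supremum"
begin

text \<open>
  For \<open>vs = [v\<^sub>1, \<dots>, v\<^sub>j]\<close> consisting of standard basis vectors, \<open>iter_deriv h vs\<close> is the partial
  derivative of \<open>h\<close> of order \<open>j\<close> along \<open>v\<^sub>j, \<dots>, v\<^sub>1\<close>. These are the entries of the tensor \<open>\<nabla>\<^sup>j h\<close>.
\<close>

primrec iter_deriv ::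
  "('a::real_normed_vector \<Rightarrow> 'b::real_normed_vector) \<Rightarrow> 'a list \<Rightarrow> 'a \<Rightarrow> 'b" where
  "iter_deriv h [] = h"
| "iter_deriv h (v # vs) = (\<lambda>z. frechet_derivative (iter_deriv h vs) (at z) v)"

definition basis_lists :: "nat \<Rightarrow> 'a::euclidean_space list set" where
  "basis_lists j = {vs. length vs = j \<and> set vs \<subseteq> Basis}"

definition C_class :: "nat \<Rightarrow> ('a::euclidean_space \<Rightarrow> 'b::euclidean_space) \<Rightarrow> bool" where
  "C_class k h \<longleftrightarrow>
     (\<forall>j<k. \<forall>vs\<in>basis_lists j. \<forall>z. iter_deriv h vs differentiable (at z)) \<and>
     (\<forall>j\<le>k. \<forall>vs\<in>basis_lists j. continuous_on UNIV (iter_deriv h vs))"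

text \<open>The Euclidean (Frobenius) norm of the tensor \<open>\<nabla>\<^sup>j h (z)\<close>.\<close>

definition nabla_norm ::
  "nat \<Rightarrow> ('a::euclidean_space \<Rightarrow> 'b::euclidean_space) \<Rightarrow> 'a \<Rightarrow> real" where
  "nabla_norm j h z = sqrt (\<Sum>vs\<in>basis_lists j. (norm (iter_deriv h vs z))\<^sup>2)"

text \<open>
  The norm of \<open>W\<^sup>k\<^sup>,\<^sup>\<infinity>\<close>, as an extended real. It is meaningful for functions of class \<open>C\<^sup>k\<close>,
  whose classical derivatives are the weak ones.
\<close>

definition W_norm :: "nat \<Rightarrow> ('a::euclidean_space \<Rightarrow> 'b::euclidean_space) \<Rightarrow> ereal" where
  "W_norm k h = Max ((\<lambda>j. esssup lebesgue (\<lambda>z. ereal (nabla_norm j h z))) ` {..k})"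

text \<open>The full gradient of \<open>g\<close> in \<open>(x, y)\<close>, as the pair of its blocks \<open>(\<nabla>\<^sub>x g, \<nabla>\<^sub>y g)\<close>.\<close>

definition full_grad ::
  "((real^'nx) \<times> (real^'ny) \<Rightarrow> real^'m) \<Rightarrow> (real^'nx) \<times> (real^'ny) \<Rightarrow>
     (real^'nx^'m) \<times> (real^'ny^'m)" where
  "full_grad g = (\<lambda>(x, y). (jacobian (\<lambda>x'. g (x', y)) (at x), jacobian (\<lambda>y'. g (x, y')) (at y)))"

definition F_fun ::
  "((real^'nx) \<times> (real^'ny) \<Rightarrow> real^'nx) \<Rightarrow> (real^'nx \<Rightarrow> real^'ny) \<Rightarrow> real^'nx \<Rightarrow> real^'nx" where
  "F_fun f \<gamma> x = f (x, \<gamma> x)"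

definition F_y ::
  "((real^'nx) \<times> (real^'ny) \<Rightarrow> real^'nx) \<Rightarrow> (real^'nx \<Rightarrow> real^'ny) \<Rightarrow> real^'nx \<Rightarrow> real^'ny^'nx" where
  "F_y f \<gamma> x = jacobian (\<lambda>y. f (x, y)) (at (\<gamma> x))"

definition G_y ::
  "((real^'nx) \<times> (real^'ny) \<Rightarrow> real^'ny) \<Rightarrow> (real^'nx \<Rightarrow> real^'ny) \<Rightarrow> real^'nx \<Rightarrow> real^'ny^'ny" where
  "G_y g \<gamma> x = jacobian (\<lambda>y. g (x, y)) (at (\<gamma> x))"

definition G_yy ::
  "((real^'nx) \<times> (real^'ny) \<Rightarrow> real^'ny) \<Rightarrow> (real^'nx \<Rightarrow> real^'ny) \<Rightarrow>
     real^'nx \<Rightarrow> 'ny \<Rightarrow> 'ny \<Rightarrow> 'ny \<Rightarrow> real" where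
  "G_yy g \<gamma> x i j k =
     frechet_derivative
       (\<lambda>y. frechet_derivative (\<lambda>y'. g (x, y') $ i) (at y) (axis k 1))
       (at (\<gamma> x)) (axis j 1)"

definition gamma1 ::
  "((real^'nx) \<times> (real^'ny) \<Rightarrow> real^'nx) \<Rightarrow> ((real^'nx) \<times> (real^'ny) \<Rightarrow> real^'ny) \<Rightarrow>
     (real^'nx \<Rightarrow> real^'ny) \<Rightarrow> real^'nx \<Rightarrow> real^'ny" where
  "gamma1 f g \<gamma> x = matrix_inv (G_y g \<gamma> x) *v (jacobian \<gamma> (at x) *v F_fun f \<gamma> x)"

definition gamma2 ::
  "((real^'nx) \<times> (real^'ny) \<Rightarrow> real^'nx) \<Rightarrow> ((real^'nx) \<times> (real^'ny) \<Rightarrow> real^'ny) \<Rightarrow>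
     (real^'nx \<Rightarrow> real^'ny) \<Rightarrow> real^'nx \<Rightarrow> real^'ny" where
  "gamma2 f g \<gamma> x = matrix_inv (G_y g \<gamma> x) *v
     (jacobian \<gamma> (at x) *v (F_y f \<gamma> x *v gamma1 f g \<gamma> x)
      + jacobian (gamma1 f g \<gamma>) (at x) *v F_fun f \<gamma> x
      - (1/2) *\<^sub>R (\<chi> i. \<Sum>j\<in>UNIV. \<Sum>k\<in>UNIV.
          G_yy g \<gamma> x i j k * gamma1 f g \<gamma> x $ j * gamma1 f g \<gamma> x $ k))"

end

theory Submission
  imports Defs
begin

text \<open>
  Since \<open>g (x, \<cdot>)\<close> is strongly monotone, it is expanding: \<open>\<beta> |y - y'| \<le> |g (x, y) - g (x, y')|\<close>.
  Hence the distance of \<open>\<Gamma>\<^sub>k\<close> from a candidate expansion is controlled by the residual of that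
  candidate in the equation defining \<open>\<Gamma>\<^sub>k\<close>, and the residuals of \<open>\<gamma> + \<epsilon> \<gamma>\<^sub>1\<close> and
  \<open>\<gamma> + \<epsilon> \<gamma>\<^sub>1 + \<epsilon>\<^sup>2 \<gamma>\<^sub>2\<close> are bounded by Taylor's formula, \<open>\<gamma>\<^sub>1\<close> and \<open>\<gamma>\<^sub>2\<close> being chosen to
  cancel the lower orders. For the gradient of \<open>\<Gamma>\<^sub>1\<close> the same argument is applied to the
  differentiated equation, which is linear in \<open>\<nabla>\<Gamma>\<^sub>1\<close>. All of \<open>\<nabla>\<gamma>\<close>, \<open>\<gamma>\<^sub>1\<close>, \<open>\<Gamma>\<^sub>1\<close>, \<open>\<Gamma>\<^sub>2\<close>
  solve equations with an expanding left-hand side, so a single implicit function argument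
  gives their regularity, and the expansion constant their bounds.
\<close>

section \<open>Continuously differentiable maps and expanding implicit equations\<close>

text \<open>The equation of the second iterate contains the gradient of the first one, and a
  sup-norm expansion says nothing about gradients. So the gradient is expanded to the same order,
  and the factor \<epsilon> of the iteration turns its second-order error into a third-order one.
  The correctors arise by inserting \<gamma> + \<epsilon> \<gamma>1 + \<epsilon>^2 \<gamma>2 into
  \<open>g\<close> and comparing with \<epsilon> (\<nabla>\<gamma> + \<epsilon> \<nabla>\<gamma>1)(F
  + \<epsilon> F_y \<gamma>1): order one gives G_y \<gamma>1 = \<nabla>\<gamma> F, and order two
  gives G_y \<gamma>2 + (1/2) G_yy[\<gamma>1, \<gamma>1] = \<nabla>\<gamma> F_y \<gamma>1 +
  \<nabla>\<gamma>1 F. Differentiating the equation of \<gamma>1 to bound its gradient would bring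
  in second derivatives of \<gamma>. Instead the equations at two points are subtracted, and the
  resulting Lipschitz constant bounds the gradient.\<close>

text \<open>Continuity of the derivative is required jointly in point and direction, so that the tangent
  map of a twice differentiable map is again an ordinary map to which \<open>C1\<close> applies.\<close>

definition C1 :: "('a::real_normed_vector \<Rightarrow> 'b::real_normed_vector) \<Rightarrow> ('a \<Rightarrow> 'a \<Rightarrow> 'b) \<Rightarrow> bool" where
  "C1 h h' \<longleftrightarrow> (\<forall>x. (h has_derivative h' x) (at x)) \<and> continuous_on UNIV (\<lambda>p. h' (fst p) (snd p))"

lemma C1D:
  assumes "C1 h h'"
  shows "(h has_derivative h' x) (at x)" "continuous_on UNIV (\<lambda>p. h' (fst p) (snd p))"
  using assms by (auto simp: C1_def)

lemma C1_continuous: "C1 h h' \<Longrightarrow> continuous_on UNIV h"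
  by (meson C1D(1) continuous_at_imp_continuous_on has_derivative_continuous)

lemma C1_continuous_derivative:
  assumes "C1 h h'" "continuous_on S a" "continuous_on S b"
  shows "continuous_on S (\<lambda>x. h' (a x) (b x))"
  using continuous_on_compose2[OF C1D(2)[OF assms(1)] continuous_on_Pair[OF assms(2,3)]] by simp

lemma C1_compose:
  assumes "C1 f f'" "C1 g g'"
  shows "C1 (\<lambda>x. f (g x)) (\<lambda>x u. f' (g x) (g' x u))"
  unfolding C1_def
proof (intro conjI allI)
  show "((\<lambda>x. f (g x)) has_derivative (\<lambda>u. f' (g x) (g' x u))) (at x)" for x
    using C1D(1) assms by (metis has_derivative_compose)
  show "continuous_on UNIV (\<lambda>p. f' (g (fst p)) (g' (fst p) (snd p)))"
    by (intro C1_continuous_derivative[OF assms(1)] C1_continuous_derivative[OF assms(2)] 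
        continuous_on_compose2[OF C1_continuous[OF assms(2)]] continuous_intros) auto
qed

lemma C1_Pair:
  assumes "C1 f f'" "C1 g g'"
  shows "C1 (\<lambda>x. (f x, g x)) (\<lambda>x u. (f' x u, g' x u))"
  using assms unfolding C1_def by (auto intro!: derivative_intros continuous_intros)

lemma C1_diff:
  assumes "C1 f f'" "C1 g g'"
  shows "C1 (\<lambda>x. f x - g x) (\<lambda>x u. f' x u - g' x u)"
  using assms unfolding C1_def by (auto intro!: derivative_intros continuous_intros)

lemma C1_bounded_linear:
  assumes "bounded_linear L"
  shows "C1 L (\<lambda>_. L)"
  unfolding C1_def
  using assms by (auto intro!: bounded_linear_imp_has_derivative 
      linear_continuous_on_compose[of _ snd, unfolded o_def] continuous_intros bounded_linear.continuous_on[OF assms])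

lemma C1_fst: "C1 fst (\<lambda>_. fst)" and C1_snd: "C1 snd (\<lambda>_. snd)" and C1_ident: "C1 (\<lambda>x. x) (\<lambda>_ u. u)"
  by (rule C1_bounded_linear, intro bounded_linear_intros)+

lemma C1_const: "C1 (\<lambda>_. c) (\<lambda>_ _. 0)"
  unfolding C1_def by auto

lemma C1_unique:
  assumes "C1 f f'" "C1 f f''"
  shows "f' = f''"
proof
  show "f' x = f'' x" for x
    using has_derivative_unique[OF C1D(1)[OF assms(1)] C1D(1)[OF assms(2)]] .
qed

section \<open>Norm bounds for derivatives and increments\<close>

text \<open>A single short step along \<open>u\<close> suffices to compare the norm of
  \<open>f' u\<close> with increments of \<open>f\<close>, from above and from below, without
  passing to a limit of quotients.\<close>

lemma has_derivative_line_approx: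
  assumes "(f has_derivative f') (at x)" and "e > 0"
  obtains t :: real where "t > 0" "norm (f (x + t *\<^sub>R u) - f x - t *\<^sub>R f' u) \<le> e * t"
proof -
  have bl: "bounded_linear f'" using assms(1) by (rule has_derivative_bounded_linear)
  \<comment> \<open>The summand 1 keeps the quotient defined for \<open>u = 0\<close>.\<close>
  let ?e = "e / (norm u + 1)"
  have n: "norm u + 1 > 0" by (simp add: add_nonneg_pos)
  have e: "?e > 0" using assms(2) by (simp add: add_nonneg_pos)
  then obtain d where d: "d > 0" "\<And>y. norm (y - x) < d \<Longrightarrow> norm (f y - f x - f' (y - x)) \<le> ?e * norm (y - x)"
    using assms(1) unfolding has_derivative_at_alt by meson
  define t where "t = d / (2 * (norm u + 1))"
  have t: "t > 0" using d(1) by (simp add: t_def add_nonneg_pos)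
  have "t * norm u \<le> t * (norm u + 1)" using t by simp
  also have "\<dots> = d / 2" using n by (simp add: t_def divide_simps)
  finally have "norm ((x + t *\<^sub>R u) - x) < d" using d(1) t by simp
  from d(2)[OF this] have "norm (f (x + t *\<^sub>R u) - f x - t *\<^sub>R f' u) \<le> ?e * (t * norm u)"
    using t by (simp add: linear_cmul[OF bounded_linear.linear[OF bl]])
  also have "\<dots> \<le> ?e * (t * (norm u + 1))" using e t by (intro mult_left_mono) auto
  also have "\<dots> = e * t" using n by simp
  finally show thesis using that t by blast
qed

text \<open>Only increments from the fixed point \<open>x\<close> enter. The use is to bound the
  gradient of \<gamma>1 by a Lipschitz constant of \<gamma>1.\<close>

lemma norm_derivative_le_lipschitz:
  assumes "(f has_derivative f') (at x)" and lip: "\<And>y. norm (f y - f x) \<le> L * norm (y - x)"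
  shows "norm (f' u) \<le> L * norm u"
proof (rule field_le_epsilon)
  fix e :: real assume "e > 0"
  with assms(1) obtain t where t: "t > 0" "norm (f (x + t *\<^sub>R u) - f x - t *\<^sub>R f' u) \<le> e * t"
    by (rule has_derivative_line_approx)
  have "t * norm (f' u) \<le> norm (f (x + t *\<^sub>R u) - f x) + e * t"
    using t norm_triangle_ineq2[of "t *\<^sub>R f' u" "f (x + t *\<^sub>R u) - f x"] by (simp add: norm_minus_commute)
  also have "\<dots> \<le> t * (L * norm u + e)"
    using lip[of "x + t *\<^sub>R u"] t(1) by (simp add: algebra_simps)
  finally show "norm (f' u) \<le> L * norm u + e" using t(1) by simp
qed

text \<open>The same short step read from below. It hands the expansion constant of \<open>g\<close>
  in its second argument to the linearisation, which yields injectivity and bounds for solutions of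
  linear equations.\<close>

lemma norm_derivative_ge_expanding:
  assumes "(f has_derivative f') (at x)" and lip: "\<And>y. L * norm (y - x) \<le> norm (f y - f x)"
  shows "L * norm u \<le> norm (f' u)"
proof (rule field_le_epsilon)
  fix e :: real assume "e > 0"
  with assms(1) obtain t where t: "t > 0" "norm (f (x + t *\<^sub>R u) - f x - t *\<^sub>R f' u) \<le> e * t"
    by (rule has_derivative_line_approx)
  have "norm (f (x + t *\<^sub>R u) - f x) \<le> t * norm (f' u) + e * t"
    using t norm_triangle_ineq2[of "f (x + t *\<^sub>R u) - f x" "t *\<^sub>R f' u"] by simp
  then have "t * (L * norm u) \<le> t * (norm (f' u) + e)"
    using lip[of "x + t *\<^sub>R u"] t(1) by (simp add: algebra_simps)
  then show "L * norm u \<le> norm (f' u) + e" using t(1) by simp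
qed

lemma lipschitz_of_derivative_bound:
  fixes f :: "'a::euclidean_space \<Rightarrow> 'b::euclidean_space"
  assumes "\<And>x. (f has_derivative f' x) (at x)" and "\<And>x v. norm (f' x v) \<le> B * norm v"
  shows "norm (f x - f y) \<le> B * norm (x - y)"
proof (rule differentiable_bound[of UNIV f f'])
  show "onorm (f' x) \<le> B" for x
    by (rule onorm_le) (rule assms(2))
qed (use assms in auto)

text \<open>A vector-valued curve need not have a mean value point. Taylor remainders are therefore
  treated as increments over the unit interval: the Taylor polynomial is subtracted along the
  segment and the velocity of the rest is bounded.\<close>

lemma norm_increment_le:
  fixes \<phi> :: "real \<Rightarrow> 'b::real_normed_vector"
  assumes "\<And>t. (\<phi> has_vector_derivative \<phi>' t) (at t)" 
    and "\<And>t. 0 \<le> t \<Longrightarrow> t \<le> 1 \<Longrightarrow> norm (\<phi>' t) \<le> B"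
  shows "norm (\<phi> 1 - \<phi> 0) \<le> B"
proof -
  have "norm (\<phi> 1 - \<phi> 0) \<le> B * norm (1 - 0 :: real)"
  proof (rule differentiable_bound[of "{0..1}" \<phi> "\<lambda>t s. s *\<^sub>R \<phi>' t"])
    show "(\<phi> has_derivative (\<lambda>s. s *\<^sub>R \<phi>' t)) (at t within {0..1})" if "t \<in> {0..1}" for t
      using assms(1)[of t] has_derivative_at_withinI unfolding has_vector_derivative_def by blast
    show "onorm (\<lambda>s. s *\<^sub>R \<phi>' t) \<le> B" if "t \<in> {0..1}" for t
      using assms(2)[of t] that by (intro onorm_le) (simp add: mult.commute[of B] mult_left_mono)
  qed auto
  then show ?thesis by simp
qed

lemma has_vector_derivative_line:
  assumes "(f has_derivative f') (at (x + t *\<^sub>R u))"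
  shows "((\<lambda>t. f (x + t *\<^sub>R u)) has_vector_derivative f' u) (at t)"
proof -
  have "((\<lambda>t. f (x + t *\<^sub>R u)) has_derivative (\<lambda>s. f' (s *\<^sub>R u))) (at t)"
    by (rule has_derivative_compose[where f="\<lambda>t. x + t *\<^sub>R u" and g=f, OF _ assms]) (auto intro!: derivative_eq_intros)
  moreover have "f' (s *\<^sub>R u) = s *\<^sub>R f' u" for s
    using assms has_derivative_linear linear_cmul by blast
  ultimately show ?thesis by (simp add: has_vector_derivative_def)
qed

lemma linear_eq_sum_Basis:
  fixes L :: "'a::euclidean_space \<Rightarrow> 'b::real_vector"
  assumes "linear L"
  shows "L v = (\<Sum>b\<in>Basis. (v \<bullet> b) *\<^sub>R L b)"
  by (subst euclidean_representation[of v, symmetric])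
    (simp only: linear_sum[OF assms] linear_cmul[OF assms])

text \<open>Finite dimension upgrades separate to joint continuity: expanding the direction in the
  basis leaves finitely many products of continuous functions.\<close>

lemma continuous_on_linear_family:
  fixes A :: "'z::topological_space \<Rightarrow> 'a::euclidean_space \<Rightarrow> 'b::real_normed_vector"
  assumes lin: "\<And>z. linear (A z)" and cont: "\<And>v. continuous_on UNIV (\<lambda>z. A z v)"
    and a: "continuous_on S a" and b: "continuous_on S b"
  shows "continuous_on S (\<lambda>x. A (a x) (b x))"
proof -
  have "continuous_on S (\<lambda>x. A (a x) i)" for i
    by (rule continuous_on_compose2[OF cont a]) auto
  then have "continuous_on S (\<lambda>x. \<Sum>i\<in>Basis. (b x \<bullet> i) *\<^sub>R A (a x) i)"
    using b by (intro continuous_intros)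
  then show ?thesis by (simp only: linear_eq_sum_Basis[OF lin, symmetric])
qed

section \<open>Implicit equations with an expanding left-hand side\<close>

text \<open>Solutions \<open>y p\<close> of \<open>\<phi> p (y p) = 0\<close> inherit the regularity of \<open>\<phi>\<close> without any inverse of
  \<open>\<phi> p\<close>, because \<open>\<phi> p\<close> is expanding.\<close>

lemma implicit_continuous:
  fixes \<phi> :: "'p::metric_space \<Rightarrow> 'b::real_normed_vector \<Rightarrow> 'c::real_normed_vector"
  assumes cont: "\<And>w. continuous_on UNIV (\<lambda>p. \<phi> p w)"
    and "\<beta> > 0" and expanding: "\<And>p w w'. \<beta> * norm (w - w') \<le> norm (\<phi> p w - \<phi> p w')"
    and zero: "\<And>p. \<phi> p (y p) = 0"
  shows "continuous_on UNIV y"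
proof (intro continuous_at_imp_continuous_on ballI)
  fix p0
  have "((\<lambda>p. norm (\<phi> p (y p0)) / \<beta>) \<longlongrightarrow> norm (\<phi> p0 (y p0)) / \<beta>) (at p0)"
    using cont[of "y p0"] \<open>\<beta> > 0\<close> by (intro tendsto_intros) (auto simp: continuous_on_def)
  then have lim: "((\<lambda>p. norm (\<phi> p (y p0)) / \<beta>) \<longlongrightarrow> 0) (at p0)" by (simp add: zero)
  \<comment> \<open>The value at \<open>p0\<close> is tested in the equation at \<open>p\<close>, so
    continuity in the parameter for a fixed unknown is enough.\<close>
  have "norm (y p - y p0) \<le> norm (\<phi> p (y p0)) / \<beta>" for p
    using expanding[of "y p" "y p0" p] \<open>\<beta> > 0\<close> by (simp add: zero field_simps)
  then have "((\<lambda>p. y p - y p0) \<longlongrightarrow> 0) (at p0)"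
    by (intro Lim_null_comparison[OF _ lim] always_eventually) auto
  then show "isCont y p0" unfolding isCont_def by (simp add: LIM_zero_iff)
qed

text \<open>The derivative is constructed before differentiability is known: \<open>y' x u\<close>
  is the root \<open>w\<close> of the linearised equation
  \<open>\<phi>' (x, y x) (u, w) = 0\<close>. Expansion makes the linear map in \<open>w\<close>
  injective, hence surjective because unknown and value share a finite-dimensional type.\<close>

lemma implicit_C1:
  fixes \<phi> :: "'a::real_normed_vector \<times> 'b::euclidean_space \<Rightarrow> 'b"
  assumes \<phi>: "C1 \<phi> \<phi>'"
    and "\<beta> > 0" and expanding: "\<And>x w w'. \<beta> * norm (w - w') \<le> norm (\<phi> (x, w) - \<phi> (x, w'))"
    and zero: "\<And>x. \<phi> (x, y x) = 0"
  obtains y' where "C1 y y'"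
proof -
  have exp': "\<beta> * norm w \<le> norm (\<phi>' (x, v) (0, w))" for x v w
  proof -
    have "((\<lambda>w. \<phi> (x, w)) has_derivative (\<lambda>w. \<phi>' (x, v) (0, w))) (at v)"
      by (rule has_derivative_compose[OF _ C1D(1)[OF \<phi>]]) (auto intro!: derivative_eq_intros)
    then show ?thesis using norm_derivative_ge_expanding expanding by blast
  qed
  have lin: "linear (\<phi>' z)" for z
    using C1D(1)[OF \<phi>] has_derivative_linear by blast
  have blin: "bounded_linear (\<phi>' z)" for z
    using C1D(1)[OF \<phi>] has_derivative_bounded_linear by blast
  have split: "\<phi>' z (u, w) - \<phi>' z (u, w') = \<phi>' z (0, w - w')" for z u w w'
    using linear_diff[OF lin, of z "(u, w)" "(u, w')"] by simp
  have cont_y: "continuous_on UNIV y"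
  proof (rule implicit_continuous[of "\<lambda>x w. \<phi> (x, w)" \<beta>])
    show "continuous_on UNIV (\<lambda>x. \<phi> (x, w))" for w
      by (rule continuous_on_compose2[OF C1_continuous[OF \<phi>]]) (auto intro!: continuous_intros)
  qed (use \<open>\<beta> > 0\<close> expanding zero in auto)
  have "\<exists>w. \<phi>' (x, y x) (u, w) = 0" for x u
  proof -
    let ?A = "\<lambda>w. \<phi>' (x, y x) (0, w)"
    have linA: "linear ?A"
      by (rule linear_compose[of "\<lambda>w. (0, w)", unfolded o_def, OF _ lin]) (auto intro!: linearI)
    have "inj ?A"
      unfolding linear_injective_0[OF linA]
    proof (intro allI impI)
      show "w = 0" if "?A w = 0" for w
        using exp'[of w x "y x"] that \<open>\<beta> > 0\<close> by (simp add: mult_le_0_iff)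
    qed
    then have "surj ?A" using linA linear_injective_imp_surjective by blast
    then obtain w where "?A w = - \<phi>' (x, y x) (u, 0)" by (metis surjD)
    then have "\<phi>' (x, y x) (u, w) = 0"
      using split[of "(x, y x)" u w 0] by simp
    then show ?thesis by blast
  qed
  then obtain y' where y': "\<And>x u. \<phi>' (x, y x) (u, y' x u) = 0" by metis
  have uniq: "y' x u = w" if "\<phi>' (x, y x) (u, w) = 0" for x u w
    using exp'[of "y' x u - w" x "y x"] that y' \<open>\<beta> > 0\<close> split[of "(x, y x)" u "y' x u" w]
    by (simp add: zero_le_mult_iff mult_le_0_iff)
  have bl_y': "bounded_linear (y' x)" for x
  proof -
    obtain B where B: "\<And>v. norm (\<phi>' (x, y x) v) \<le> norm v * B"
      using blin bounded_linear.bounded by metis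
    show ?thesis
    proof (rule bounded_linear_intro)
      show "y' x (u + v) = y' x u + y' x v" for u v
        using linear_add[OF lin, of "(x, y x)" "(u, y' x u)" "(v, y' x v)"] y' by (intro uniq) simp
      show "y' x (c *\<^sub>R u) = c *\<^sub>R y' x u" for c u
        using linear_cmul[OF lin, of "(x, y x)" c "(u, y' x u)"] y' by (intro uniq) simp
      show "norm (y' x u) \<le> norm u * (B / \<beta>)" for u
      proof -
        have "\<beta> * norm (y' x u) \<le> norm (\<phi>' (x, y x) (0, y' x u))" by (rule exp')
        also have "\<phi>' (x, y x) (0, y' x u) = - \<phi>' (x, y x) (u, 0)"
          using split[of "(x, y x)" u "y' x u" 0] y'[of x u] by simp
        also have "norm \<dots> \<le> norm u * B" using B[of "(u, 0)"] by simp
        finally show ?thesis using \<open>\<beta> > 0\<close> by (simp add: field_simps)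
      qed
    qed
  qed
  have "(y has_derivative y' x) (at x)" for x
    unfolding has_derivative_at_alt
  proof (intro conjI bl_y' allI impI)
    fix e :: real assume "e > 0"
    obtain B where B: "B > 0" "\<And>u. norm (y' x u) \<le> norm u * B"
      using bl_y' bounded_linear.pos_bounded by metis
    \<comment> \<open>The bound \<beta>/2 lets the increment of \<open>y\<close> on the right be
      absorbed, leaving \<open>?N + ?Y \<le> ?N * (2 * B + 2)\<close>. The second bound then turns
      this into the required error \<open>e * ?N\<close>.\<close>
    define \<eta> where "\<eta> = min (\<beta> / 2) (e * \<beta> / (2 * B + 2))"
    have \<eta>: "\<eta> > 0" "\<eta> \<le> \<beta> / 2" "\<eta> \<le> e * \<beta> / (2 * B + 2)"
      using \<open>e > 0\<close> \<open>\<beta> > 0\<close> B(1) unfolding \<eta>_def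
      by (simp, intro min.cobounded1, intro min.cobounded2)
    have \<eta>B: "\<eta> * (2 * B + 2) \<le> e * \<beta>"
      using \<eta>(3) B(1) by (subst (asm) pos_le_divide_eq) auto
    obtain d where d: "d > 0" "\<And>z. norm (z - (x, y x)) < d \<Longrightarrow>
        norm (\<phi> z - \<phi> (x, y x) - \<phi>' (x, y x) (z - (x, y x))) \<le> \<eta> * norm (z - (x, y x))"
      using C1D(1)[OF \<phi>, of "(x, y x)"] \<eta>(1) unfolding has_derivative_at_alt by meson
    \<comment> \<open>Continuity of \<open>y\<close> keeps the nearby graph point inside the ball on
      which the linearisation of \<phi> has relative error \<eta>.\<close>
    obtain d1 where d1: "d1 > 0" "\<And>x'. norm (x' - x) < d1 \<Longrightarrow> norm (y x' - y x) < d / 2"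
      using cont_y \<open>d > 0\<close> unfolding continuous_on_iff by (metis dist_norm half_gt_zero iso_tuple_UNIV_I)
    have "norm (y x' - y x - y' x (x' - x)) \<le> e * norm (x' - x)" if x': "norm (x' - x) < min d1 (d / 2)" for x'
    proof -
      let ?N = "norm (x' - x)" and ?Y = "norm (y x' - y x)" and ?r = "y x' - y x - y' x (x' - x)"
      have nle: "norm ((x', y x') - (x, y x)) \<le> ?N + ?Y" by (simp add: norm_Pair_le)
      then have "norm ((x', y x') - (x, y x)) < d" using x' d1(2)[of x'] by simp
      from d(2)[OF this] have "norm (\<phi>' (x, y x) (x' - x, y x' - y x)) \<le> \<eta> * norm ((x', y x') - (x, y x))"
        by (simp add: zero)
      also have "\<phi>' (x, y x) (x' - x, y x' - y x) = \<phi>' (x, y x) (0, ?r)"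
        using split[of "(x, y x)" "x' - x" "y x' - y x" "y' x (x' - x)"] by (simp add: y')
      finally have r: "\<beta> * norm ?r \<le> \<eta> * (?N + ?Y)"
        using exp'[of ?r x "y x"] mult_left_mono[OF nle less_imp_le[OF \<eta>(1)]] by linarith
      have Y: "?Y \<le> norm ?r + ?N * B"
        using norm_triangle_ineq[of ?r "y' x (x' - x)"] B(2)[of "x' - x"] by simp
      have "\<eta> * (?N + ?Y) \<le> (\<beta> / 2) * (?N + ?Y)" using \<eta>(2) by (intro mult_right_mono) auto
      with r have "\<beta> * norm ?r \<le> \<beta> * ((?N + ?Y) / 2)" by simp
      then have "norm ?r \<le> (?N + ?Y) / 2" using \<open>\<beta> > 0\<close> by simp
      with Y have "?N + ?Y \<le> ?N * (2 * B + 2)" by (simp add: algebra_simps)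
      with r \<eta>(1) have "\<beta> * norm ?r \<le> \<eta> * (?N * (2 * B + 2))"
        by (meson mult_left_mono order_trans less_imp_le)
      also have "\<dots> = (\<eta> * (2 * B + 2)) * ?N" by simp
      also have "\<dots> \<le> (e * \<beta>) * ?N" using \<eta>B by (intro mult_right_mono) auto
      finally have "\<beta> * norm ?r \<le> \<beta> * (e * ?N)" by (simp add: mult_ac)
      then show ?thesis using \<open>\<beta> > 0\<close> by simp
    qed
    then show "\<exists>d>0. \<forall>x'. norm (x' - x) < d \<longrightarrow> norm (y x' - y x - y' x (x' - x)) \<le> e * norm (x' - x)"
      using \<open>d > 0\<close> \<open>d1 > 0\<close> by (metis half_gt_zero min_less_iff_conj)
  qed
  \<comment> \<open>The linearised equation is itself expanding in its unknown, with the pair of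
    point and direction as parameter.\<close>
  moreover have "continuous_on UNIV (\<lambda>p. y' (fst p) (snd p))"
  proof (rule implicit_continuous[of "\<lambda>p w. \<phi>' (fst p, y (fst p)) (snd p, w)" \<beta>])
    show "continuous_on UNIV (\<lambda>p. \<phi>' (fst p, y (fst p)) (snd p, w))" for w
      by (intro C1_continuous_derivative[OF \<phi>] continuous_intros continuous_on_compose2[OF cont_y]) auto
  qed (use \<open>\<beta> > 0\<close> exp' y' split in auto)
  ultimately show thesis using that unfolding C1_def by blast
qed

section \<open>Maps with bounded first and Lipschitz second derivatives\<close>

text \<open>The velocity of the curve without its linear part is at most
  \<open>L * t * (norm w)\<^sup>2\<close>. Estimating \<open>t\<close> by 1 gives the constant
  \<open>L\<close> in place of the sharp half of it.\<close>

lemma taylor_order1: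
  fixes h :: "'a::real_normed_vector \<Rightarrow> 'b::real_normed_vector"
  assumes deriv: "\<And>z. (h has_derivative h' z) (at z)" and "L \<ge> 0"
    and lip: "\<And>z z' v. norm (h' z' v - h' z v) \<le> L * norm (z' - z) * norm v"
  shows "norm (h (z + w) - h z - h' z w) \<le> L * (norm w)\<^sup>2"
proof -
  let ?\<phi> = "\<lambda>t. h (z + t *\<^sub>R w) - t *\<^sub>R h' z w"
  have "norm (?\<phi> 1 - ?\<phi> 0) \<le> L * (norm w)\<^sup>2"
  proof (rule norm_increment_le)
    show "(?\<phi> has_vector_derivative h' (z + t *\<^sub>R w) w - h' z w) (at t)" for t
      by (auto intro!: derivative_eq_intros has_vector_derivative_line deriv)
    show "norm (h' (z + t *\<^sub>R w) w - h' z w) \<le> L * (norm w)\<^sup>2" if "0 \<le> t" "t \<le> 1" for t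
    proof -
      have "norm (h' (z + t *\<^sub>R w) w - h' z w) \<le> L * (t * norm w) * norm w"
        using lip[of "z + t *\<^sub>R w" w z] that by simp
      also have "\<dots> = t * (L * (norm w)\<^sup>2)" by (simp add: power2_eq_square)
      also have "\<dots> \<le> 1 * (L * (norm w)\<^sup>2)" using that \<open>L \<ge> 0\<close> by (intro mult_right_mono) auto
      finally show ?thesis by simp
    qed
  qed
  then show ?thesis by (simp add: algebra_simps)
qed

text \<open>The Lipschitz bound on \<open>D2\<close> stands in for a bound on the third derivative.\<close>

locale bounded_C21 =
  fixes g :: "'a::euclidean_space \<Rightarrow> 'b::euclidean_space"
    and D1 :: "'a \<Rightarrow> 'a \<Rightarrow> 'b" and D2 :: "'a \<Rightarrow> 'a \<Rightarrow> 'a \<Rightarrow> 'b" and M :: real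
  assumes g_deriv: "\<And>z. (g has_derivative D1 z) (at z)"
    and D1_deriv: "\<And>z v. ((\<lambda>z. D1 z v) has_derivative D2 z v) (at z)"
    and D1_bound: "\<And>z v. norm (D1 z v) \<le> M * norm v"
    and D2_bound: "\<And>z v w. norm (D2 z v w) \<le> M * norm v * norm w"
    and D2_lip: "\<And>z z' v w. norm (D2 z' v w - D2 z v w) \<le> M * norm (z' - z) * norm v * norm w"
    and M_nonneg: "M \<ge> 0"
begin

lemma linear_D1: "linear (D1 z)"
  using g_deriv has_derivative_linear by blast

lemma linear_D2_right: "linear (D2 z v)"
  using D1_deriv has_derivative_linear by blast

text \<open>Linearity in the first slot is that of \<open>D1 z\<close>, carried over by uniqueness
  of the derivative in \<open>z\<close>.\<close>

lemma linear_D2_left: "linear (\<lambda>v. D2 z v w)"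
proof (rule linearI)
  have "D2 z (u + v) = (\<lambda>w. D2 z u w + D2 z v w)" for u v
    by (rule has_derivative_unique[OF D1_deriv]) (simp add: linear_add[OF linear_D1] D1_deriv has_derivative_add)
  then show "D2 z (u + v) w = D2 z u w + D2 z v w" for u v by metis
  have "D2 z (c *\<^sub>R v) = (\<lambda>w. c *\<^sub>R D2 z v w)" for c v
    by (rule has_derivative_unique[OF D1_deriv]) (simp add: linear_cmul[OF linear_D1] D1_deriv has_derivative_scaleR_right)
  then show "D2 z (c *\<^sub>R v) w = c *\<^sub>R D2 z v w" for c v by metis
qed

lemma D1_lip: "norm (D1 z' v - D1 z v) \<le> M * norm (z' - z) * norm v"
  using lipschitz_of_derivative_bound[of "\<lambda>z. D1 z v" "\<lambda>z. D2 z v" "M * norm v" z' z, OF D1_deriv D2_bound]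
  by (simp add: mult_ac)

lemma taylor_g1: "norm (g (z + w) - g z - D1 z w) \<le> M * (norm w)\<^sup>2"
  using g_deriv M_nonneg D1_lip by (rule taylor_order1)

lemma taylor_D1: "norm (D1 (z + w) v - D1 z v - D2 z v w) \<le> M * norm v * (norm w)\<^sup>2"
proof (rule taylor_order1)
  show "((\<lambda>z. D1 z v) has_derivative D2 z v) (at z)" for z by (rule D1_deriv)
  show "norm (D2 z' v u - D2 z v u) \<le> M * norm v * norm (z' - z) * norm u" for z z' u
    using D2_lip[of z' v u z] by (simp add: mult_ac)
qed (use M_nonneg in auto)

text \<open>Once the quadratic Taylor polynomial is removed, the velocity along the segment is
  exactly the remainder treated in \<open>taylor_D1\<close>, taken in direction
  \<open>w\<close>.\<close>

lemma taylor_g2: "norm (g (z + w) - g z - D1 z w - (1/2) *\<^sub>R D2 z w w) \<le> M * (norm w)^3"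
proof -
  let ?\<phi> = "\<lambda>t. g (z + t *\<^sub>R w) - t *\<^sub>R D1 z w - (t\<^sup>2 / 2) *\<^sub>R D2 z w w"
  have "norm (?\<phi> 1 - ?\<phi> 0) \<le> M * (norm w)^3"
  proof (rule norm_increment_le)
    show "(?\<phi> has_vector_derivative D1 (z + t *\<^sub>R w) w - D1 z w - t *\<^sub>R D2 z w w) (at t)" for t
      by (auto intro!: derivative_eq_intros has_vector_derivative_line g_deriv)
    show "norm (D1 (z + t *\<^sub>R w) w - D1 z w - t *\<^sub>R D2 z w w) \<le> M * (norm w)^3" if "0 \<le> t" "t \<le> 1" for t
    proof -
      have "norm (D1 (z + t *\<^sub>R w) w - D1 z w - t *\<^sub>R D2 z w w) \<le> M * norm w * (t * norm w)\<^sup>2"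
        using taylor_D1[of z "t *\<^sub>R w" w] that by (simp add: linear_cmul[OF linear_D2_right])
      also have "\<dots> = t\<^sup>2 * (M * (norm w)^3)" by (simp add: power2_eq_square power3_eq_cube)
      also have "\<dots> \<le> 1 * (M * (norm w)^3)" using that M_nonneg by (intro mult_right_mono) (auto simp: power_le_one)
      finally show ?thesis by simp
    qed
  qed
  then show ?thesis by (simp add: algebra_simps)
qed

text \<open>The symmetry of the second difference in \<open>v\<close> and \<open>w\<close> passes to \<open>D2\<close> by scaling both to zero.\<close>

lemma D2_second_difference:
  "norm (g (z + v + w) - g (z + v) - g (z + w) + g z - D2 z v w) \<le> M * norm v * norm w * (norm v + norm w)"
proof -
  \<comment> \<open>Its increment over the unit interval is the second difference minus
    \<open>D2 z v w\<close>. The curve moves along \<open>v\<close> only; the displacement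
    \<open>w\<close> is handled by \<open>taylor_D1\<close>.\<close>
  let ?\<phi> = "\<lambda>t. g (z + w + t *\<^sub>R v) - g (z + t *\<^sub>R v) - t *\<^sub>R D2 z v w"
  have "norm (?\<phi> 1 - ?\<phi> 0) \<le> M * norm v * norm w * (norm v + norm w)"
  proof (rule norm_increment_le)
    show "(?\<phi> has_vector_derivative D1 (z + w + t *\<^sub>R v) v - D1 (z + t *\<^sub>R v) v - D2 z v w) (at t)" for t
      by (auto intro!: derivative_eq_intros has_vector_derivative_line g_deriv)
    show "norm (D1 (z + w + t *\<^sub>R v) v - D1 (z + t *\<^sub>R v) v - D2 z v w) \<le> M * norm v * norm w * (norm v + norm w)"
      if "0 \<le> t" "t \<le> 1" for t
    proof -
      let ?z = "z + t *\<^sub>R v"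
      have "norm (D1 (?z + w) v - D1 ?z v - D2 z v w)
          \<le> norm (D1 (?z + w) v - D1 ?z v - D2 ?z v w) + norm (D2 ?z v w - D2 z v w)"
        using norm_triangle_ineq[of "D1 (?z + w) v - D1 ?z v - D2 ?z v w" "D2 ?z v w - D2 z v w"]
        by (simp add: algebra_simps)
      also have "\<dots> \<le> M * norm v * (norm w)\<^sup>2 + M * (t * norm v) * norm v * norm w"
        using taylor_D1[of ?z w v] D2_lip[of ?z v w z] that by simp
      also have "\<dots> \<le> M * norm v * (norm w)\<^sup>2 + M * (1 * norm v) * norm v * norm w"
        using that M_nonneg by (intro add_left_mono mult_right_mono mult_left_mono) auto
      finally show ?thesis by (simp add: algebra_simps power2_eq_square)
    qed
  qed
  then show ?thesis by (simp add: algebra_simps)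
qed

text \<open>Differentiating the equation of \<gamma>1 puts the corrector into the first slot of
  \<open>D2\<close>, whereas Taylor expansion of \<open>D1\<close> puts it into the second. Symmetry
  lets the two terms cancel.\<close>

lemma D2_commute: "D2 z v w = D2 z w v"
proof -
  let ?d = "norm (D2 z v w - D2 z w v)" and ?c = "2 * M * norm v * norm w * (norm v + norm w)"
  have c: "?c \<ge> 0" using M_nonneg by simp
  have scaled: "?d \<le> s * ?c" if s: "s > 0" for s
  proof -
    let ?\<Delta> = "\<lambda>v w. g (z + v + w) - g (z + v) - g (z + w) + g z"
    have D2s: "D2 z (s *\<^sub>R v) (s *\<^sub>R w) = s\<^sup>2 *\<^sub>R D2 z v w" for v w
      by (simp add: linear_cmul[OF linear_D2_right] linear_cmul[OF linear_D2_left] power2_eq_square)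
    have "s\<^sup>2 * ?d = norm (D2 z (s *\<^sub>R v) (s *\<^sub>R w) - D2 z (s *\<^sub>R w) (s *\<^sub>R v))"
      by (simp add: D2s flip: scaleR_diff_right)
    also have "\<dots> \<le> norm (?\<Delta> (s *\<^sub>R v) (s *\<^sub>R w) - D2 z (s *\<^sub>R v) (s *\<^sub>R w))
        + norm (?\<Delta> (s *\<^sub>R w) (s *\<^sub>R v) - D2 z (s *\<^sub>R w) (s *\<^sub>R v))"
      using norm_triangle_ineq4[of "?\<Delta> (s *\<^sub>R w) (s *\<^sub>R v) - D2 z (s *\<^sub>R w) (s *\<^sub>R v)" "?\<Delta> (s *\<^sub>R v) (s *\<^sub>R w) - D2 z (s *\<^sub>R v) (s *\<^sub>R w)"]
      by (simp add: algebra_simps)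
    also have "\<dots> \<le> M * (s * norm v) * (s * norm w) * (s * norm v + s * norm w)
        + M * (s * norm w) * (s * norm v) * (s * norm w + s * norm v)"
      using D2_second_difference[of z "s *\<^sub>R v" "s *\<^sub>R w"] D2_second_difference[of z "s *\<^sub>R w" "s *\<^sub>R v"] s
      by simp
    also have "\<dots> = s\<^sup>2 * (s * ?c)" by (simp add: algebra_simps power2_eq_square)
    finally show ?thesis using s by simp
  qed
  have "?d \<le> e" if "e > 0" for e
  proof -
    \<comment> \<open>The scaling multiplies \<open>?d\<close> by \<open>s\<^sup>2\<close> and the
      error by \<open>s^3\<close>, so a small \<open>s\<close> pushes \<open>?d\<close> below
      \<open>e\<close>. The summand 1 covers \<open>?c = 0\<close>.\<close>
    have "?d \<le> (e / (?c + 1)) * ?c" using that c by (intro scaled) auto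
    also have "\<dots> \<le> e"
      using that c by (simp add: divide_simps)
    finally show ?thesis .
  qed
  then have "?d \<le> 0" using field_le_epsilon[of ?d 0] by simp
  then show ?thesis by simp
qed

lemma continuous_on_D1:
  assumes "continuous_on S a" "continuous_on S b"
  shows "continuous_on S (\<lambda>x. D1 (a x) (b x))"
  using linear_D1 _ assms
proof (rule continuous_on_linear_family)
  show "continuous_on UNIV (\<lambda>z. D1 z v)" for v
    using D1_deriv has_derivative_continuous by (intro continuous_at_imp_continuous_on ballI) blast
qed

lemma continuous_on_D2:
  assumes "continuous_on S a" "continuous_on S b" "continuous_on S c"
  shows "continuous_on S (\<lambda>x. D2 (a x) (b x) (c x))"
proof -
  have "continuous_on UNIV (\<lambda>z. D2 z v w)" for v w
  proof (rule lipschitz_on_continuous_on)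
    show "((M * norm v * norm w)-lipschitz_on UNIV (\<lambda>z. D2 z v w))"
      using D2_lip[of _ v w] M_nonneg by (auto intro!: lipschitz_onI simp: dist_norm mult_ac)
  qed
  then have "continuous_on UNIV (\<lambda>p. D2 (fst p) v (snd p))" for v
    by (rule continuous_on_linear_family[where A="\<lambda>z. D2 z v", OF linear_D2_right])
      (intro continuous_intros)+
  then have "continuous_on S (\<lambda>x. (\<lambda>p v. D2 (fst p) v (snd p)) (a x, c x) (b x))"
    by (rule continuous_on_linear_family[where A="\<lambda>p v. D2 (fst p) v (snd p)", OF linear_D2_left])
      (intro continuous_intros assms)+
  then show ?thesis by simp
qed

lemma C1_g: "C1 g D1"
  unfolding C1_def using g_deriv by (intro conjI allI continuous_on_D1 continuous_on_fst continuous_on_snd continuous_on_id)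

text \<open>\<open>D1_deriv\<close> differentiates in the point for a fixed direction only. Writing
  the direction in the basis reduces the joint derivative to the product rule for finitely many
  terms.\<close>

lemma C1_tangent: "C1 (\<lambda>p. D1 (fst p) (snd p)) (\<lambda>p q. D2 (fst p) (snd p) (fst q) + D1 (fst p) (snd q))"
  unfolding C1_def
proof (intro conjI allI)
  fix p :: "'a \<times> 'a"
  have "((\<lambda>p. \<Sum>i\<in>Basis. (snd p \<bullet> i) *\<^sub>R D1 (fst p) i) has_derivative
      (\<lambda>q. \<Sum>i\<in>Basis. (snd p \<bullet> i) *\<^sub>R D2 (fst p) i (fst q) + (snd q \<bullet> i) *\<^sub>R D1 (fst p) i)) (at p)"
    by (intro derivative_intros has_derivative_compose[OF _ D1_deriv, where f=fst]) 
  also have "(\<lambda>p. \<Sum>i\<in>Basis. (snd p \<bullet> i) *\<^sub>R D1 (fst p) i) = (\<lambda>p. D1 (fst p) (snd p))"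
    by (rule ext) (simp only: linear_eq_sum_Basis[OF linear_D1, symmetric])
  also have "(\<lambda>q. \<Sum>i\<in>Basis. (snd p \<bullet> i) *\<^sub>R D2 (fst p) i (fst q) + (snd q \<bullet> i) *\<^sub>R D1 (fst p) i)
     = (\<lambda>q. D2 (fst p) (snd p) (fst q) + D1 (fst p) (snd q))"
    by (rule ext) (simp only: sum.distrib linear_eq_sum_Basis[OF linear_D1, symmetric] linear_eq_sum_Basis[OF linear_D2_left, symmetric])
  finally show "((\<lambda>p. D1 (fst p) (snd p)) has_derivative (\<lambda>q. D2 (fst p) (snd p) (fst q) + D1 (fst p) (snd q))) (at p)" .
qed (intro continuous_on_add continuous_on_D1 continuous_on_D2 continuous_on_fst continuous_on_snd continuous_on_id)

end

section \<open>The slow manifold and its correctors\<close>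

lemma C1_frechet_derivative:
  assumes "C1 y y'"
  shows "C1 y (\<lambda>x. frechet_derivative y (at x))"
proof -
  have "(\<lambda>x. frechet_derivative y (at x)) = y'"
    using frechet_derivative_at[OF C1D(1)[OF assms]] by auto
  then show ?thesis using assms by simp
qed

lemma C1_derivative_at_const:
  assumes "C1 h h'" "\<And>x. h x = c"
  shows "h' x u = 0"
proof -
  have "h = (\<lambda>_. c)" using assms(2) by auto
  then have "h' x = (\<lambda>_. 0)"
    using has_derivative_unique[OF C1D(1)[OF assms(1), of x]] by auto
  then show ?thesis by simp
qed

text \<open>Collects what is available before any corrector is fixed. The equation of \<gamma>2
  contains the derivative of \<gamma>1, so \<open>C1_first_order_corrector\<close> has to be at hand
  before that equation can be established.\<close>

locale fast_equilibrium = bounded_C21 g D1 D2 M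
  for g :: "'a::euclidean_space \<times> 'b::euclidean_space \<Rightarrow> 'b" and D1 D2 M +
  fixes f :: "'a \<times> 'b \<Rightarrow> 'a" and Df :: "'a \<times> 'b \<Rightarrow> 'a \<times> 'b \<Rightarrow> 'a"
    and \<gamma> :: "'a \<Rightarrow> 'b" and \<beta> :: real
  assumes f_deriv: "\<And>z. (f has_derivative Df z) (at z)"
    and f_bound: "\<And>z. norm (f z) \<le> M"
    and Df_bound: "\<And>z v. norm (Df z v) \<le> M * norm v"
    and Df_lip: "\<And>z z' v. norm (Df z' v - Df z v) \<le> M * norm (z' - z) * norm v"
    and g_zero: "\<And>x. g (x, \<gamma> x) = 0"
    and beta_pos: "\<beta> > 0"
    and expanding: "\<And>x y y'. \<beta> * norm (y - y') \<le> norm (g (x, y) - g (x, y'))"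
begin

abbreviation d\<gamma> where "d\<gamma> x \<equiv> frechet_derivative \<gamma> (at x)"

lemma D1_expanding: "\<beta> * norm w \<le> norm (D1 z (0, w))"
proof -
  obtain x v where z: "z = (x, v)" by fastforce
  have "((\<lambda>w. g (x, w)) has_derivative (\<lambda>w. D1 (x, v) (0, w))) (at v)"
    by (rule has_derivative_compose[OF _ g_deriv]) (auto intro!: derivative_eq_intros)
  then show ?thesis unfolding z using norm_derivative_ge_expanding expanding by blast
qed

lemma D1_diff: "D1 z (u, w) - D1 z (u, w') = D1 z (0, w - w')"
  using linear_diff[OF linear_D1, of z "(u, w)" "(u, w')"] by simp

lemma norm_le_D1: "norm (D1 z (0, w)) \<le> c \<Longrightarrow> norm w \<le> c / \<beta>"
  using D1_expanding[of w z] beta_pos by (simp add: field_simps)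

lemma norm_le_g: "norm (g (x, y) - g (x, y')) \<le> c \<Longrightarrow> norm (y - y') \<le> c / \<beta>"
  using expanding[of y y' x] beta_pos by (simp add: field_simps)

lemma C1_f: "C1 f Df"
  unfolding C1_def
proof (intro conjI allI f_deriv continuous_on_linear_family[where A=Df and a=fst and b=snd] continuous_on_fst continuous_on_snd continuous_on_id)
  show "linear (Df z)" for z using f_deriv has_derivative_linear by blast
  show "continuous_on UNIV (\<lambda>z. Df z v)" for v
  proof (rule lipschitz_on_continuous_on)
    show "((M * norm v)-lipschitz_on UNIV (\<lambda>z. Df z v))"
      using Df_lip[of _ v] M_nonneg by (auto intro!: lipschitz_onI simp: dist_norm mult_ac)
  qed
qed

lemma linear_Df: "linear (Df z)"
  using f_deriv has_derivative_linear by blast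

lemma continuous_solution:
  assumes "continuous_on UNIV r" "\<And>x. g (x, y x) = r x"
  shows "continuous_on UNIV y"
proof (rule implicit_continuous[of "\<lambda>x w. g (x, w) - r x" \<beta>])
  show "continuous_on UNIV (\<lambda>x. g (x, w) - r x)" for w
    by (intro continuous_intros assms continuous_on_compose2[OF C1_continuous[OF C1_g]]) auto
qed (use assms beta_pos expanding in auto)

lemma C1_solution:
  assumes r: "C1 r r'" and eq: "\<And>x. g (x, y x) = r x"
  shows "C1 y (\<lambda>x. frechet_derivative y (at x))"
proof (rule implicit_C1[of "\<lambda>p. g p - r (fst p)" "\<lambda>p q. D1 p q - r' (fst p) (fst q)" \<beta> y])
  show "C1 (\<lambda>p. g p - r (fst p)) (\<lambda>p q. D1 p q - r' (fst p) (fst q))"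
    by (intro C1_diff C1_g C1_compose[OF r C1_fst])
qed (use beta_pos expanding eq C1_frechet_derivative in auto)

lemma continuous_linear_solution:
  fixes z :: "'p::metric_space \<Rightarrow> 'a \<times> 'b"
  assumes "continuous_on UNIV z" "continuous_on UNIV u" "continuous_on UNIV r"
    and "\<And>p. D1 (z p) (u p, w p) = r p"
  shows "continuous_on UNIV w"
proof (rule implicit_continuous[of "\<lambda>p v. D1 (z p) (u p, v) - r p" \<beta>])
  show "continuous_on UNIV (\<lambda>p. D1 (z p) (u p, v) - r p)" for v
    by (intro continuous_intros assms continuous_on_D1)
qed (use assms beta_pos D1_expanding D1_diff in auto)

text \<open>With parameter and unknown joined into one variable \<open>q\<close>, the left-hand side
  becomes the tangent map of \<open>g\<close> along a C1 map, so \<open>C1_tangent\<close> provides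
  the regularity that \<open>implicit_C1\<close> asks for.\<close>

lemma C1_linear_solution:
  fixes z :: "'p::euclidean_space \<Rightarrow> 'a \<times> 'b"
  assumes z: "C1 z z'" and u: "C1 u u'" and r: "C1 r r'" 
    and eq: "\<And>p. D1 (z p) (u p, w p) = r p"
  shows "C1 w (\<lambda>p. frechet_derivative w (at p))"
proof -
  have "C1 (\<lambda>q. (z (fst q), (u (fst q), snd q))) (\<lambda>q d. (z' (fst q) (fst d), (u' (fst q) (fst d), snd d)))"
    by (intro C1_Pair C1_compose[OF z C1_fst] C1_compose[OF u C1_fst] C1_snd)
  from C1_diff[OF C1_compose[OF C1_tangent this] C1_compose[OF r C1_fst]]
  have "\<exists>\<phi>'. C1 (\<lambda>q. D1 (z (fst q)) (u (fst q), snd q) - r (fst q)) \<phi>'" by auto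
  then obtain \<phi>' where "C1 (\<lambda>q. D1 (z (fst q)) (u (fst q), snd q) - r (fst q)) \<phi>'" ..
  then obtain w' where "C1 w w'"
    by (rule implicit_C1[where \<beta> = \<beta> and y = w]) (use beta_pos D1_expanding D1_diff eq in auto)
  then show ?thesis by (rule C1_frechet_derivative)
qed

lemma C1_\<gamma>: "C1 \<gamma> d\<gamma>"
  by (rule C1_solution[OF C1_const g_zero])

lemma C1_graph: "C1 (\<lambda>x. (x, \<gamma> x)) (\<lambda>x u. (u, d\<gamma> x u))"
  by (intro C1_Pair C1_ident C1_\<gamma>)

lemma d\<gamma>_eq: "D1 (x, \<gamma> x) (u, d\<gamma> x u) = 0"
  by (rule C1_derivative_at_const[OF C1_compose[OF C1_g C1_graph] g_zero])

text \<open>Point and direction together are the parameter, so this contains second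
  differentiability of \<gamma>. Only existence of \<open>T\<close> is recorded: the derivative of
  the right-hand side is later read off from the equation of \<gamma>1.\<close>

lemma C1_d\<gamma>: "\<exists>T. C1 (\<lambda>p. d\<gamma> (fst p) (snd p)) T"
  by (rule exI) (rule C1_linear_solution[OF C1_compose[OF C1_graph C1_fst] C1_snd C1_const], rule d\<gamma>_eq)

lemma C1_rhs: "\<exists>T. C1 (\<lambda>x. d\<gamma> x (f (x, \<gamma> x))) T"
proof -
  obtain T where "C1 (\<lambda>p. d\<gamma> (fst p) (snd p)) T" using C1_d\<gamma> by blast
  from C1_compose[OF this C1_Pair[OF C1_ident C1_compose[OF C1_f C1_graph]]] show ?thesis
    unfolding fst_conv snd_conv
    by (rule exI[where x="\<lambda>x u. T (x, f (x, \<gamma> x)) (u, Df (x, \<gamma> x) (u, d\<gamma> x u))"])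
qed

lemma C1_first_order_corrector:
  assumes "\<And>x. D1 (x, \<gamma> x) (0, w x) = d\<gamma> x (f (x, \<gamma> x))"
  shows "C1 w (\<lambda>x. frechet_derivative w (at x))"
proof -
  obtain T where "C1 (\<lambda>x. d\<gamma> x (f (x, \<gamma> x))) T" using C1_rhs by blast
  then show ?thesis by (rule C1_linear_solution[OF C1_graph C1_const _ assms])
qed

end

text \<open>The correctors enter through linear equations free of matrices:
  \<open>D1 (x, \<gamma> x) (0, w)\<close> is G_y applied to \<open>w\<close>, and \<open>D2\<close>
  on two vertical vectors is the quadratic form G_yy.\<close>

locale slow_manifold = fast_equilibrium +
  fixes \<gamma>1 \<gamma>2 :: "'a \<Rightarrow> 'b"
  assumes \<gamma>1_eq: "\<And>x. D1 (x, \<gamma> x) (0, \<gamma>1 x) = d\<gamma> x (f (x, \<gamma> x))"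
    and \<gamma>2_eq: "\<And>x. D1 (x, \<gamma> x) (0, \<gamma>2 x) = d\<gamma> x (Df (x, \<gamma> x) (0, \<gamma>1 x))
        + frechet_derivative \<gamma>1 (at x) (f (x, \<gamma> x)) - (1/2) *\<^sub>R D2 (x, \<gamma> x) (0, \<gamma>1 x) (0, \<gamma>1 x)"
begin

abbreviation d\<gamma>1 where "d\<gamma>1 x \<equiv> frechet_derivative \<gamma>1 (at x)"

lemmas C1_\<gamma>1 = C1_first_order_corrector[OF \<gamma>1_eq]

lemma linear_d\<gamma>: "linear (d\<gamma> x)" and linear_d\<gamma>1: "linear (d\<gamma>1 x)"
  using has_derivative_linear[OF C1D(1)[OF C1_\<gamma>]] has_derivative_linear[OF C1D(1)[OF C1_\<gamma>1]] by auto

text \<open>Serves the order-zero Sobolev norm of the second expansion, whose essential supremum is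
  bounded with the help of continuity.\<close>

lemma continuous_\<gamma>2: "continuous_on UNIV \<gamma>2"
proof (rule continuous_linear_solution[OF _ _ _ \<gamma>2_eq])
  note graph = C1_continuous[OF C1_graph] and \<gamma>1 = C1_continuous[OF C1_\<gamma>1]
  show "continuous_on UNIV (\<lambda>x. (x, \<gamma> x))" by (rule graph)
  show "continuous_on UNIV (\<lambda>x. d\<gamma> x (Df (x, \<gamma> x) (0, \<gamma>1 x)) + d\<gamma>1 x (f (x, \<gamma> x))
        - (1/2) *\<^sub>R D2 (x, \<gamma> x) (0, \<gamma>1 x) (0, \<gamma>1 x))"
    by (intro continuous_on_add continuous_on_diff continuous_on_scaleR continuous_on_const continuous_on_Pair 
        continuous_on_D2 C1_continuous_derivative[OF C1_\<gamma>] C1_continuous_derivative[OF C1_\<gamma>1]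
        C1_continuous_derivative[OF C1_f] graph \<gamma>1 continuous_on_id C1_continuous[OF C1_compose[OF C1_f C1_graph]])
qed simp

section \<open>Uniform bounds for the slow manifold and its correctors\<close>

lemma d\<gamma>_bound: "norm (d\<gamma> x u) \<le> M / \<beta> * norm u"
proof -
  have "D1 (x, \<gamma> x) (0, d\<gamma> x u) = - D1 (x, \<gamma> x) (u, 0)"
    using D1_diff[of "(x, \<gamma> x)" u "d\<gamma> x u" 0] d\<gamma>_eq by simp
  then have "norm (D1 (x, \<gamma> x) (0, d\<gamma> x u)) \<le> M * norm u"
    using D1_bound[of "(x, \<gamma> x)" "(u, 0)"] by simp
  then show ?thesis by (rule norm_le_D1[THEN order_trans]) simp
qed

lemma graph_tangent_bound: "norm (u, d\<gamma> x u) \<le> (1 + M / \<beta>) * norm u"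
  using norm_Pair_le[of u "d\<gamma> x u"] d\<gamma>_bound[of x u] by (simp add: algebra_simps)

lemma graph_lip: "norm ((x, \<gamma> x) - (x', \<gamma> x')) \<le> (1 + M / \<beta>) * norm (x - x')"
  using C1D(1)[OF C1_graph] graph_tangent_bound by (rule lipschitz_of_derivative_bound)

lemma D1_graph_lip: "norm (D1 (x, \<gamma> x) v - D1 (x', \<gamma> x') v) \<le> M * (1 + M / \<beta>) * norm (x - x') * norm v"
proof -
  have "norm (D1 (x, \<gamma> x) v - D1 (x', \<gamma> x') v) \<le> M * norm ((x, \<gamma> x) - (x', \<gamma> x')) * norm v" by (rule D1_lip)
  also have "\<dots> \<le> M * ((1 + M / \<beta>) * norm (x - x')) * norm v"
    using graph_lip M_nonneg by (intro mult_right_mono mult_left_mono) auto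
  finally show ?thesis by (simp add: mult_ac)
qed

lemma f_lip: "norm (f z - f z') \<le> M * norm (z - z')"
  using f_deriv Df_bound by (rule lipschitz_of_derivative_bound)

text \<open>Subtracting the tangent equations at \<open>x\<close> and \<open>x'\<close> leaves the
  change of \<open>D1\<close> applied to one tangent vector. One factor
  \<open>1 + M / \<beta>\<close> is the Lipschitz constant of the graph, the other the size of that
  vector.\<close>

lemma d\<gamma>_lip: "norm (d\<gamma> x v - d\<gamma> x' v) \<le> M * (1 + M / \<beta>)\<^sup>2 / \<beta> * norm (x - x') * norm v"
proof -
  have "D1 (x, \<gamma> x) (0, d\<gamma> x v - d\<gamma> x' v) = D1 (x', \<gamma> x') (v, d\<gamma> x' v) - D1 (x, \<gamma> x) (v, d\<gamma> x' v)"
    using D1_diff[of "(x, \<gamma> x)" v "d\<gamma> x v" "d\<gamma> x' v"] by (simp add: d\<gamma>_eq)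
  then have "norm (D1 (x, \<gamma> x) (0, d\<gamma> x v - d\<gamma> x' v)) \<le> M * (1 + M / \<beta>) * norm (x - x') * norm (v, d\<gamma> x' v)"
    using D1_graph_lip by (metis norm_minus_commute)
  also have "\<dots> \<le> M * (1 + M / \<beta>) * norm (x - x') * ((1 + M / \<beta>) * norm v)"
    using graph_tangent_bound M_nonneg beta_pos by (intro mult_left_mono) auto
  finally show ?thesis
    by (rule norm_le_D1[THEN order_trans]) (simp add: power2_eq_square mult_ac)
qed

lemma rhs_bound: "norm (d\<gamma> x (f (x, \<gamma> x))) \<le> M / \<beta> * M"
  using d\<gamma>_bound[of x "f (x, \<gamma> x)"] mult_left_mono[OF f_bound[of "(x, \<gamma> x)"], of "M / \<beta>"] M_nonneg beta_pos
  by simp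

lemma \<gamma>1_bound: "norm (\<gamma>1 x) \<le> M / \<beta> * M / \<beta>"
  by (rule norm_le_D1[of "(x, \<gamma> x)"]) (simp only: \<gamma>1_eq rhs_bound)

lemma rhs_lip: "\<exists>L\<ge>0. \<forall>x x'. norm (d\<gamma> x (f (x, \<gamma> x)) - d\<gamma> x' (f (x', \<gamma> x'))) \<le> L * norm (x - x')"
proof (intro exI conjI allI)
  let ?c = "1 + M / \<beta>"
  \<comment> \<open>The first summand comes from varying \<open>f\<close> under a fixed
    \<open>d\<gamma> x\<close>, the second from varying \<open>d\<gamma>\<close> on a fixed
    vector.\<close>
  let ?L = "M / \<beta> * (M * ?c) + M * ?c\<^sup>2 / \<beta> * M"
  show "?L \<ge> 0" using M_nonneg beta_pos by simp
  fix x x'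
  let ?F = "\<lambda>x. f (x, \<gamma> x)"
  have "norm (d\<gamma> x (?F x) - d\<gamma> x (?F x')) \<le> M / \<beta> * norm (?F x - ?F x')"
    using d\<gamma>_bound by (simp flip: linear_diff[OF linear_d\<gamma>])
  also have "norm (?F x - ?F x') \<le> M * norm ((x, \<gamma> x) - (x', \<gamma> x'))" by (rule f_lip)
  also have "norm ((x, \<gamma> x) - (x', \<gamma> x')) \<le> ?c * norm (x - x')" by (rule graph_lip)
  finally have 1: "norm (d\<gamma> x (?F x) - d\<gamma> x (?F x')) \<le> M / \<beta> * (M * (?c * norm (x - x')))"
    using M_nonneg beta_pos by (simp add: mult_left_mono divide_right_mono)
  have "norm (d\<gamma> x (?F x') - d\<gamma> x' (?F x')) \<le> M * ?c\<^sup>2 / \<beta> * norm (x - x') * norm (?F x')" by (rule d\<gamma>_lip)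
  also have "\<dots> \<le> M * ?c\<^sup>2 / \<beta> * norm (x - x') * M"
    using f_bound M_nonneg beta_pos by (intro mult_left_mono) auto
  finally have 2: "norm (d\<gamma> x (?F x') - d\<gamma> x' (?F x')) \<le> M * ?c\<^sup>2 / \<beta> * norm (x - x') * M" .
  have "norm (d\<gamma> x (?F x) - d\<gamma> x' (?F x'))
      \<le> norm (d\<gamma> x (?F x) - d\<gamma> x (?F x')) + norm (d\<gamma> x (?F x') - d\<gamma> x' (?F x'))"
    using norm_triangle_ineq[of "d\<gamma> x (?F x) - d\<gamma> x (?F x')" "d\<gamma> x (?F x') - d\<gamma> x' (?F x')"] by simp
  also have "\<dots> \<le> M / \<beta> * (M * (?c * norm (x - x'))) + M * ?c\<^sup>2 / \<beta> * norm (x - x') * M"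
    using 1 2 by (rule add_mono)
  also have "\<dots> = ?L * norm (x - x')" by (simp add: algebra_simps)
  finally show "norm (d\<gamma> x (?F x) - d\<gamma> x' (?F x')) \<le> ?L * norm (x - x')" .
qed

lemma d\<gamma>1_bound: "\<exists>L\<ge>0. \<forall>x u. norm (d\<gamma>1 x u) \<le> L * norm u"
proof -
  obtain L where L: "L \<ge> 0" "\<And>x x'. norm (d\<gamma> x (f (x, \<gamma> x)) - d\<gamma> x' (f (x', \<gamma> x'))) \<le> L * norm (x - x')"
    using rhs_lip by blast
  let ?b = "M / \<beta> * M / \<beta>" and ?c = "M * (1 + M / \<beta>)"
  \<comment> \<open>\<open>L\<close> accounts for the change of the right-hand side,
    \<open>?c * ?b\<close> for the change of \<open>D1\<close> acting on \<gamma>1; division by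
    \<beta> solves for the increment of \<gamma>1.\<close>
  let ?K = "(L + ?c * ?b) / \<beta>"
  have lip: "norm (\<gamma>1 x' - \<gamma>1 x) \<le> ?K * norm (x' - x)" for x x'
  proof -
    have "D1 (x', \<gamma> x') (0, \<gamma>1 x' - \<gamma>1 x) = (d\<gamma> x' (f (x', \<gamma> x')) - d\<gamma> x (f (x, \<gamma> x)))
        - (D1 (x', \<gamma> x') (0, \<gamma>1 x) - D1 (x, \<gamma> x) (0, \<gamma>1 x))"
      using D1_diff[of "(x', \<gamma> x')" 0 "\<gamma>1 x'" "\<gamma>1 x"] by (simp add: \<gamma>1_eq)
    then have "norm (D1 (x', \<gamma> x') (0, \<gamma>1 x' - \<gamma>1 x)) \<le> norm (d\<gamma> x' (f (x', \<gamma> x')) - d\<gamma> x (f (x, \<gamma> x)))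
        + norm (D1 (x', \<gamma> x') (0, \<gamma>1 x) - D1 (x, \<gamma> x) (0, \<gamma>1 x))"
      by (metis norm_triangle_ineq4)
    also have "\<dots> \<le> L * norm (x' - x) + ?c * norm (x' - x) * norm ((0::'a), \<gamma>1 x)"
      by (intro add_mono L D1_graph_lip)
    also have "\<dots> \<le> L * norm (x' - x) + ?c * norm (x' - x) * ?b"
      using \<gamma>1_bound[of x] M_nonneg beta_pos by (intro add_left_mono mult_left_mono) auto
    also have "\<dots> = (L + ?c * ?b) * norm (x' - x)" by (simp only: distrib_right) (simp only: mult_ac)
    finally show ?thesis by (rule norm_le_D1[THEN order_trans]) (simp only: times_divide_eq_left order_refl)
  qed
  have "norm (d\<gamma>1 x u) \<le> ?K * norm u" for x u
    using C1D(1)[OF C1_\<gamma>1] lip by (rule norm_derivative_le_lipschitz)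
  moreover have "?K \<ge> 0" using L M_nonneg beta_pos by simp
  ultimately show ?thesis by blast
qed

lemma uniform_bounds:
  obtains L where "L \<ge> 0" "\<And>x u. norm (d\<gamma> x u) \<le> L * norm u" "\<And>x. norm (\<gamma>1 x) \<le> L"
    "\<And>x u. norm (d\<gamma>1 x u) \<le> L * norm u" "\<And>x. norm (\<gamma>2 x) \<le> L"
proof -
  obtain L1 where L1: "L1 \<ge> 0" "\<And>x u. norm (d\<gamma>1 x u) \<le> L1 * norm u" using d\<gamma>1_bound by blast
  define a where "a = M / \<beta>"
  define b where "b = M / \<beta> * M / \<beta>"
  \<comment> \<open>The three summands bound the three terms on the right of the equation of
    \<gamma>2.\<close>
  define c where "c = (a * (M * b) + L1 * M + (1/2) * (M * b * b)) / \<beta>"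
  have pos: "a \<ge> 0" "b \<ge> 0" "c \<ge> 0"
    using M_nonneg beta_pos L1(1) by (auto simp: a_def b_def c_def)
  have dg: "norm (d\<gamma> x u) \<le> a * norm u" for x u using d\<gamma>_bound by (simp add: a_def)
  have g1: "norm (\<gamma>1 x) \<le> b" for x using \<gamma>1_bound by (simp add: b_def)
  have g2: "norm (\<gamma>2 x) \<le> c" for x
  proof -
    have Fy: "norm (Df (x, \<gamma> x) (0, \<gamma>1 x)) \<le> M * b"
      using Df_bound[of "(x, \<gamma> x)" "(0, \<gamma>1 x)"] mult_left_mono[OF g1 M_nonneg, of x] by simp
    have "norm (d\<gamma> x (Df (x, \<gamma> x) (0, \<gamma>1 x))) \<le> a * (M * b)"
      using dg mult_left_mono[OF Fy pos(1)] order_trans by blast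
    moreover have "norm (d\<gamma>1 x (f (x, \<gamma> x))) \<le> L1 * M"
      using L1(2) mult_left_mono[OF f_bound L1(1)] order_trans by blast
    moreover have "norm ((1/2) *\<^sub>R D2 (x, \<gamma> x) (0, \<gamma>1 x) (0, \<gamma>1 x)) \<le> (1/2) * (M * b * b)"
    proof -
      have "norm (D2 (x, \<gamma> x) (0, \<gamma>1 x) (0, \<gamma>1 x)) \<le> M * norm (\<gamma>1 x) * norm (\<gamma>1 x)"
        using D2_bound[of "(x, \<gamma> x)" "(0, \<gamma>1 x)" "(0, \<gamma>1 x)"] by simp
      also have "\<dots> \<le> M * b * b" using g1 M_nonneg pos by (intro mult_mono) auto
      finally show ?thesis by simp
    qed
    ultimately have "norm (D1 (x, \<gamma> x) (0, \<gamma>2 x)) \<le> a * (M * b) + L1 * M + (1/2) * (M * b * b)"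
      unfolding \<gamma>2_eq by (intro norm_triangle_le_diff add_mono norm_triangle_le) 
    then show ?thesis unfolding c_def by (rule norm_le_D1)
  qed
  show thesis
  proof (rule that[of "a + b + c + L1"])
    show "norm (d\<gamma> x u) \<le> (a + b + c + L1) * norm u" for x u
      by (rule order_trans[OF dg mult_right_mono]) (use pos L1(1) in simp_all)
    show "norm (d\<gamma>1 x u) \<le> (a + b + c + L1) * norm u" for x u
      by (rule order_trans[OF L1(2) mult_right_mono]) (use pos L1(1) in simp_all)
    show "norm (\<gamma>1 x) \<le> a + b + c + L1" "norm (\<gamma>2 x) \<le> a + b + c + L1" for x
      using g1[of x] g2[of x] pos L1(1) by auto
  qed (use pos L1(1) in auto)
qed


section \<open>Expansions of the first two iterates\<close>

text \<open>A predicate on a single pair of \<epsilon> and \<Gamma> allows constants to be chosen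
  before both, which is the uniformity behind the Landau symbols. The bound
  \<open>\<epsilon> \<le> 1\<close> is there to absorb higher powers of \<epsilon> into lower
  ones.\<close>

definition first_iterate :: "real \<Rightarrow> ('a \<Rightarrow> 'b) \<Rightarrow> bool" where
  "first_iterate \<epsilon> \<Gamma> \<longleftrightarrow> 0 < \<epsilon> \<and> \<epsilon> \<le> 1 \<and> (\<forall>x. g (x, \<Gamma> x) = \<epsilon> *\<^sub>R d\<gamma> x (f (x, \<gamma> x)))"

lemma first_iterateD:
  assumes "first_iterate \<epsilon> \<Gamma>"
  shows "0 < \<epsilon>" "\<epsilon> \<le> 1" "g (x, \<Gamma> x) = \<epsilon> *\<^sub>R d\<gamma> x (f (x, \<gamma> x))"
  using assms by (auto simp: first_iterate_def)

lemma first_iterate_C1: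
  assumes "first_iterate \<epsilon> \<Gamma>"
  shows "C1 \<Gamma> (\<lambda>x. frechet_derivative \<Gamma> (at x))"
proof -
  obtain T where "C1 (\<lambda>x. d\<gamma> x (f (x, \<gamma> x))) T" using C1_rhs by blast
  from C1_compose[OF C1_bounded_linear[OF bounded_linear_scaleR_right] this] first_iterateD(3)[OF assms]
  show ?thesis by (rule C1_solution)
qed

lemma second_iterate_continuous:
  assumes \<Gamma>: "C1 \<Gamma> \<Gamma>'" and "\<And>x. g (x, \<Gamma>2 x) = \<epsilon> *\<^sub>R \<Gamma>' x (f (x, \<Gamma> x))"
  shows "continuous_on UNIV \<Gamma>2"
proof (rule continuous_solution[OF _ assms(2)])
  show "continuous_on UNIV (\<lambda>x. \<epsilon> *\<^sub>R \<Gamma>' x (f (x, \<Gamma> x)))"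
    by (intro continuous_on_scaleR continuous_on_const C1_continuous_derivative[OF \<Gamma>] continuous_on_id
        C1_continuous[OF C1_compose[OF C1_f C1_Pair[OF C1_ident \<Gamma>]]])
qed

text \<open>By the equation of \<gamma>1 the linear Taylor term of \<open>g\<close> at \<gamma> +
  \<epsilon> \<gamma>1 equals the right-hand side exactly. The residual is thus a pure second-order
  remainder, at most \<open>M * (\<epsilon> * L)\<^sup>2\<close>.\<close>

lemma first_iterate_expansion:
  "\<exists>C\<ge>0. \<forall>\<epsilon> \<Gamma> x. first_iterate \<epsilon> \<Gamma> \<longrightarrow> norm (\<Gamma> x - \<gamma> x - \<epsilon> *\<^sub>R \<gamma>1 x) \<le> C * \<epsilon>\<^sup>2"
proof -
  obtain L where L: "L \<ge> 0" "\<And>x u. norm (d\<gamma> x u) \<le> L * norm u" "\<And>x. norm (\<gamma>1 x) \<le> L"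
    "\<And>x u. norm (d\<gamma>1 x u) \<le> L * norm u" "\<And>x. norm (\<gamma>2 x) \<le> L" by (rule uniform_bounds, rule that)
  show ?thesis
  proof (intro exI[of _ "M * L\<^sup>2 / \<beta>"] conjI allI impI)
    show "M * L\<^sup>2 / \<beta> \<ge> 0" using M_nonneg beta_pos by simp
    fix \<epsilon> :: real and \<Gamma> x
    assume "first_iterate \<epsilon> \<Gamma>"
    note eps = first_iterateD(1,2)[OF this] and eq = first_iterateD(3)[OF this]
    let ?w = "(0 :: 'a, \<epsilon> *\<^sub>R \<gamma>1 x)"
    have "D1 (x, \<gamma> x) ?w = \<epsilon> *\<^sub>R d\<gamma> x (f (x, \<gamma> x))"
      using linear_cmul[OF linear_D1, of "(x, \<gamma> x)" \<epsilon> "(0, \<gamma>1 x)"] by (simp add: \<gamma>1_eq)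
    then have "norm (g (x, \<Gamma> x) - g (x, \<gamma> x + \<epsilon> *\<^sub>R \<gamma>1 x)) \<le> M * (norm ?w)\<^sup>2"
      using taylor_g1[of "(x, \<gamma> x)" ?w] by (simp add: g_zero eq norm_minus_commute)
    also have "\<dots> = M * (\<epsilon> * norm (\<gamma>1 x))\<^sup>2" using eps by simp
    also have "\<dots> \<le> M * (\<epsilon> * L)\<^sup>2"
      using L(1) L(3)[of x] eps M_nonneg by (intro mult_left_mono power_mono) auto
    finally show "norm (\<Gamma> x - \<gamma> x - \<epsilon> *\<^sub>R \<gamma>1 x) \<le> M * L\<^sup>2 / \<beta> * \<epsilon>\<^sup>2"
      using norm_le_g[of x "\<Gamma> x" "\<gamma> x + \<epsilon> *\<^sub>R \<gamma>1 x"]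
      by (simp add: power_mult_distrib mult_ac diff_diff_eq)
  qed
qed

text \<open>The equation of \<gamma>1 rewrites the right-hand side as
  \<open>D1 (x, \<gamma> x) (0, \<gamma>1 x)\<close>. Differentiating this form avoids any
  expression in second derivatives of \<gamma>.\<close>

lemma rhs_derivative:
  assumes "C1 (\<lambda>x. d\<gamma> x (f (x, \<gamma> x))) h'"
  shows "h' x u = D2 (x, \<gamma> x) (0, \<gamma>1 x) (u, d\<gamma> x u) + D1 (x, \<gamma> x) (0, d\<gamma>1 x u)"
proof -
  have "C1 (\<lambda>x. D1 (x, \<gamma> x) (0, \<gamma>1 x)) (\<lambda>x u. D2 (x, \<gamma> x) (0, \<gamma>1 x) (u, d\<gamma> x u) + D1 (x, \<gamma> x) (0, d\<gamma>1 x u))"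
    using C1_compose[OF C1_tangent C1_Pair[OF C1_graph C1_Pair[OF C1_const C1_\<gamma>1]], of 0] by simp
  then have "C1 (\<lambda>x. d\<gamma> x (f (x, \<gamma> x)))
      (\<lambda>x u. D2 (x, \<gamma> x) (0, \<gamma>1 x) (u, d\<gamma> x u) + D1 (x, \<gamma> x) (0, d\<gamma>1 x u))"
    by (simp only: \<gamma>1_eq)
  from C1_unique[OF assms this] show ?thesis by (simp only:)
qed

lemma first_iterate_derivative_eq:
  assumes first: "first_iterate \<epsilon> \<Gamma>" and \<Gamma>: "C1 \<Gamma> \<Gamma>'"
  shows "D1 (x, \<Gamma> x) (u, \<Gamma>' x u)
    = \<epsilon> *\<^sub>R (D2 (x, \<gamma> x) (0, \<gamma>1 x) (u, d\<gamma> x u) + D1 (x, \<gamma> x) (0, d\<gamma>1 x u))"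
proof -
  obtain h' where h': "C1 (\<lambda>x. d\<gamma> x (f (x, \<gamma> x))) h'" using C1_rhs by blast
  have 1: "C1 (\<lambda>x. g (x, \<Gamma> x)) (\<lambda>x u. \<epsilon> *\<^sub>R h' x u)"
    unfolding first_iterateD(3)[OF first] by (rule C1_compose[OF C1_bounded_linear[OF bounded_linear_scaleR_right] h'])
  have 2: "C1 (\<lambda>x. g (x, \<Gamma> x)) (\<lambda>x u. D1 (x, \<Gamma> x) (u, \<Gamma>' x u))"
    by (rule C1_compose[OF C1_g C1_Pair[OF C1_ident \<Gamma>]])
  have "\<epsilon> *\<^sub>R h' x u = D1 (x, \<Gamma> x) (u, \<Gamma>' x u)"
    using C1_unique[OF 1 2] by (rule fun_cong[OF fun_cong])
  then show ?thesis by (simp only: rhs_derivative[OF h'])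
qed

text \<open>The candidate tangent
  \<open>(u, d\<gamma> x u + \<epsilon> *\<^sub>R d\<gamma>1 x u)\<close> is inserted into the
  differentiated equation. Its residual has three sources: Taylor expansion of \<open>D1\<close> on
  the graph tangent, the change of \<open>D1\<close> on the correction, and the replacement of
  \<Gamma> by its own expansion.\<close>

lemma first_iterate_derivative_expansion:
  "\<exists>C\<ge>0. \<forall>\<epsilon> \<Gamma> \<Gamma>' x u. first_iterate \<epsilon> \<Gamma> \<and> C1 \<Gamma> \<Gamma>' \<longrightarrow>
     norm (\<Gamma>' x u - d\<gamma> x u - \<epsilon> *\<^sub>R d\<gamma>1 x u) \<le> C * \<epsilon>\<^sup>2 * norm u"
proof -
  obtain L where L: "L \<ge> 0" "\<And>x u. norm (d\<gamma> x u) \<le> L * norm u" "\<And>x. norm (\<gamma>1 x) \<le> L"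
    "\<And>x u. norm (d\<gamma>1 x u) \<le> L * norm u" "\<And>x. norm (\<gamma>2 x) \<le> L" by (rule uniform_bounds, rule that)
  obtain C0 where C0: "C0 \<ge> 0"
    "\<And>\<epsilon> \<Gamma> x. first_iterate \<epsilon> \<Gamma> \<Longrightarrow> norm (\<Gamma> x - \<gamma> x - \<epsilon> *\<^sub>R \<gamma>1 x) \<le> C0 * \<epsilon>\<^sup>2"
    using first_iterate_expansion by blast
  \<comment> \<open>The summands are the constants of \<open>t1\<close>, \<open>t2\<close> and
    \<open>t3\<close>, in this order.\<close>
  let ?C = "M * (1 + L) * L\<^sup>2 + M * L\<^sup>2 + M * C0 * (1 + 2 * L)"
  show ?thesis
  proof (intro exI[of _ "?C / \<beta>"] conjI allI impI)
    show "?C / \<beta> \<ge> 0" using M_nonneg beta_pos L(1) C0(1) by simp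
    fix \<epsilon> :: real and \<Gamma> \<Gamma>' x u
    assume "first_iterate \<epsilon> \<Gamma> \<and> C1 \<Gamma> \<Gamma>'"
    then have first: "first_iterate \<epsilon> \<Gamma>" and \<Gamma>: "C1 \<Gamma> \<Gamma>'" by auto
    note eps = first_iterateD(1,2)[OF first]
    let ?z = "(x, \<gamma> x)" and ?a = "(0 :: 'a, \<gamma>1 x)" and ?b = "(0 :: 'a, d\<gamma>1 x u)"
    let ?V = "(u, d\<gamma> x u)" and ?n = "norm u"
    let ?P = "?z + \<epsilon> *\<^sub>R ?a"
    have a: "norm ?a \<le> L" using L(3) by simp
    have b: "norm ?b \<le> L * ?n" using L(4) by simp
    have V: "norm ?V \<le> (1 + L) * ?n"
      using norm_Pair_le[of u "d\<gamma> x u"] L(2)[of x u] by (simp add: algebra_simps)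
    have "norm (\<epsilon> *\<^sub>R ?b) \<le> 1 * (L * ?n)"
      using b eps unfolding norm_scaleR by (intro mult_mono) auto
    then have VP: "norm (?V + \<epsilon> *\<^sub>R ?b) \<le> (1 + 2 * L) * ?n"
      using V norm_triangle_ineq[of ?V "\<epsilon> *\<^sub>R ?b"] by (simp add: algebra_simps)
    have w: "norm (\<epsilon> *\<^sub>R ?a) \<le> \<epsilon> * L" using a eps by simp
    have t1: "norm (D1 ?P ?V - D1 ?z ?V - D2 ?z ?V (\<epsilon> *\<^sub>R ?a)) \<le> M * (1 + L) * L\<^sup>2 * \<epsilon>\<^sup>2 * ?n"
    proof -
      have "norm (D1 ?P ?V - D1 ?z ?V - D2 ?z ?V (\<epsilon> *\<^sub>R ?a)) \<le> M * norm ?V * (norm (\<epsilon> *\<^sub>R ?a))\<^sup>2"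
        by (rule taylor_D1)
      also have "\<dots> \<le> M * ((1 + L) * ?n) * (\<epsilon> * L)\<^sup>2"
        using V w M_nonneg L(1) by (intro mult_mono power_mono) auto
      finally show ?thesis by (simp add: power_mult_distrib mult_ac)
    qed
    have t2: "norm (\<epsilon> *\<^sub>R (D1 ?P ?b - D1 ?z ?b)) \<le> M * L\<^sup>2 * \<epsilon>\<^sup>2 * ?n"
    proof -
      have "norm (D1 ?P ?b - D1 ?z ?b) \<le> M * norm (\<epsilon> *\<^sub>R ?a) * norm ?b"
        using D1_lip[of ?P ?b ?z] by simp
      also have "\<dots> \<le> M * (\<epsilon> * L) * (L * ?n)"
        using w b M_nonneg L(1) eps by (intro mult_mono) auto
      finally have "\<epsilon> * norm (D1 ?P ?b - D1 ?z ?b) \<le> \<epsilon> * (M * (\<epsilon> * L) * (L * ?n))"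
        using eps by simp
      then show ?thesis using eps by (simp add: power2_eq_square mult_ac)
    qed
    have t3: "norm (D1 (x, \<Gamma> x) (?V + \<epsilon> *\<^sub>R ?b) - D1 ?P (?V + \<epsilon> *\<^sub>R ?b)) \<le> M * C0 * (1 + 2 * L) * \<epsilon>\<^sup>2 * ?n"
    proof -
      have "norm (D1 (x, \<Gamma> x) (?V + \<epsilon> *\<^sub>R ?b) - D1 ?P (?V + \<epsilon> *\<^sub>R ?b)) \<le> M * norm ((x, \<Gamma> x) - ?P) * norm (?V + \<epsilon> *\<^sub>R ?b)"
        by (rule D1_lip)
      also have "norm ((x, \<Gamma> x) - ?P) \<le> C0 * \<epsilon>\<^sup>2" 
        using C0(2)[OF first, of x] by (simp add: diff_diff_eq)
      also have "M * (C0 * \<epsilon>\<^sup>2) * norm (?V + \<epsilon> *\<^sub>R ?b) \<le> M * (C0 * \<epsilon>\<^sup>2) * ((1 + 2 * L) * ?n)"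
        using VP M_nonneg C0(1) by (intro mult_left_mono) auto
      finally show ?thesis using M_nonneg by (simp add: mult_ac mult_right_mono mult_left_mono)
    qed
    have tri: "norm (- p - q - r) \<le> a + b + c" if "norm p \<le> a" "norm q \<le> b" "norm r \<le> c" for p q r :: 'b and a b c
      using norm_triangle_ineq4[of "- p - q" r] norm_triangle_ineq4[of "- p" q] norm_minus_cancel[of p] that
      by linarith
    let ?e = "\<Gamma>' x u - d\<gamma> x u - \<epsilon> *\<^sub>R d\<gamma>1 x u"
    have "D1 (x, \<Gamma> x) (0, ?e) = D1 (x, \<Gamma> x) (u, \<Gamma>' x u) - D1 (x, \<Gamma> x) (?V + \<epsilon> *\<^sub>R ?b)"
      by (simp add: D1_diff diff_diff_eq)
    \<comment> \<open>Symmetry of \<open>D2\<close> brings the term into the slot order in which it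
      appears in \<open>t1\<close>.\<close>
    also have "D1 (x, \<Gamma> x) (u, \<Gamma>' x u) = D2 ?z ?V (\<epsilon> *\<^sub>R ?a) + \<epsilon> *\<^sub>R D1 ?z ?b"
      by (simp only: first_iterate_derivative_eq[OF first \<Gamma>] linear_cmul[OF linear_D2_right] scaleR_add_right D2_commute[of ?z ?a])
    \<comment> \<open>The base point moves from \<open>?z\<close> through \<open>?P\<close> to
      \<open>(x, \<Gamma> x)\<close>. The zeroth-order term \<open>D1 ?z ?V\<close> vanishes because
      \<open>?V\<close> is tangent to the graph of \<gamma>.\<close>
    also have "\<dots> - D1 (x, \<Gamma> x) (?V + \<epsilon> *\<^sub>R ?b) = 
        - (D1 ?P ?V - D1 ?z ?V - D2 ?z ?V (\<epsilon> *\<^sub>R ?a)) - \<epsilon> *\<^sub>R (D1 ?P ?b - D1 ?z ?b)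
        - (D1 (x, \<Gamma> x) (?V + \<epsilon> *\<^sub>R ?b) - D1 ?P (?V + \<epsilon> *\<^sub>R ?b))"
      unfolding linear_add[OF linear_D1, of ?P] linear_cmul[OF linear_D1, of ?P] d\<gamma>_eq
      by (simp only: scaleR_diff_right) (simp add: algebra_simps)
    also have "norm \<dots> \<le> M * (1 + L) * L\<^sup>2 * \<epsilon>\<^sup>2 * ?n + M * L\<^sup>2 * \<epsilon>\<^sup>2 * ?n + M * C0 * (1 + 2 * L) * \<epsilon>\<^sup>2 * ?n"
      by (rule tri[OF t1 t2 t3])
    also have "\<dots> = ?C * (\<epsilon>\<^sup>2 * ?n)" by (simp only: distrib_right mult.assoc)
    finally have "norm ?e \<le> ?C * (\<epsilon>\<^sup>2 * ?n) / \<beta>" by (rule norm_le_D1)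
    then show "norm ?e \<le> ?C / \<beta> * \<epsilon>\<^sup>2 * ?n" by (simp only: times_divide_eq_left mult.assoc)
  qed
qed

lemma second_iterate_expansion:
  "\<exists>C\<ge>0. \<forall>\<epsilon> \<Gamma> \<Gamma>' \<Gamma>2 x. first_iterate \<epsilon> \<Gamma> \<and> C1 \<Gamma> \<Gamma>' \<and> (\<forall>x. g (x, \<Gamma>2 x) = \<epsilon> *\<^sub>R \<Gamma>' x (f (x, \<Gamma> x))) \<longrightarrow>
     norm (\<Gamma>2 x - \<gamma> x - \<epsilon> *\<^sub>R \<gamma>1 x - \<epsilon>\<^sup>2 *\<^sub>R \<gamma>2 x) \<le> C * \<epsilon>^3"
proof -
  obtain L where L: "L \<ge> 0" "\<And>x u. norm (d\<gamma> x u) \<le> L * norm u" "\<And>x. norm (\<gamma>1 x) \<le> L"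
    "\<And>x u. norm (d\<gamma>1 x u) \<le> L * norm u" "\<And>x. norm (\<gamma>2 x) \<le> L" by (rule uniform_bounds, rule that)
  obtain C0 where C0: "C0 \<ge> 0"
    "\<And>\<epsilon> \<Gamma> x. first_iterate \<epsilon> \<Gamma> \<Longrightarrow> norm (\<Gamma> x - \<gamma> x - \<epsilon> *\<^sub>R \<gamma>1 x) \<le> C0 * \<epsilon>\<^sup>2"
    using first_iterate_expansion by blast
  obtain C1' where C1': "C1' \<ge> 0" "\<And>\<epsilon> \<Gamma> \<Gamma>' x u. first_iterate \<epsilon> \<Gamma> \<Longrightarrow> C1 \<Gamma> \<Gamma>' \<Longrightarrow>
     norm (\<Gamma>' x u - d\<gamma> x u - \<epsilon> *\<^sub>R d\<gamma>1 x u) \<le> C1' * \<epsilon>\<^sup>2 * norm u"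
    using first_iterate_derivative_expansion by blast
  \<comment> \<open>Bounds the second-order error of \<open>f\<close> along the iterate: the first
    term replaces \<Gamma> by \<gamma> + \<epsilon> \<gamma>1, the second is the Taylor remainder of
    \<open>f\<close>.\<close>
  define C2 where "C2 = M * C0 + M * L\<^sup>2"
  have C2: "C2 \<ge> 0" using M_nonneg C0(1) by (simp add: C2_def)
  \<comment> \<open>The terms bound \<open>d\<gamma>\<close> on the remainder \<rho>, the correction
    \<open>d\<gamma>1\<close> on all of \<open>?\<Phi>\<close> beyond \<open>?F\<close>, and the
    gradient error applied to \<open>f\<close>.\<close>
  define E where "E = L * C2 + L * (M * L + C2) + C1' * M"
  \<comment> \<open>The cube comes from \<open>norm ?w \<le> 2 * L * \<epsilon>\<close> in the
    Taylor remainder; \<open>2 * M * L\<^sup>2\<close> rounds up half of the constant 3 in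
    \<open>quad\<close>.\<close>
  define R where "R = M * (2 * L)^3 + 2 * M * L\<^sup>2"
  show ?thesis
  proof (intro exI[of _ "(E + R) / \<beta>"] conjI allI impI)
    show "(E + R) / \<beta> \<ge> 0" using M_nonneg beta_pos L(1) C1'(1) C2 by (simp add: E_def R_def)
    fix \<epsilon> :: real and \<Gamma> \<Gamma>' \<Gamma>2 x
    assume "first_iterate \<epsilon> \<Gamma> \<and> C1 \<Gamma> \<Gamma>' \<and> (\<forall>x. g (x, \<Gamma>2 x) = \<epsilon> *\<^sub>R \<Gamma>' x (f (x, \<Gamma> x)))"
    then have first: "first_iterate \<epsilon> \<Gamma>" and \<Gamma>: "C1 \<Gamma> \<Gamma>'"
      and eq2: "\<And>x. g (x, \<Gamma>2 x) = \<epsilon> *\<^sub>R \<Gamma>' x (f (x, \<Gamma> x))" by auto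
    note eps = first_iterateD(1,2)[OF first]
    have eps2: "\<epsilon>\<^sup>2 \<le> \<epsilon>" using eps by (simp add: power2_eq_square mult_left_le_one_le)
    let ?z = "(x, \<gamma> x)" and ?a = "(0 :: 'a, \<gamma>1 x)" and ?b = "(0 :: 'a, \<gamma>2 x)"
    let ?F = "f ?z" and ?\<Phi> = "f (x, \<Gamma> x)" and ?Fy = "Df ?z ?a"
    have a: "norm ?a \<le> L" and b: "norm ?b \<le> L" using L by simp_all
    define \<rho> where "\<rho> = ?\<Phi> - ?F - \<epsilon> *\<^sub>R ?Fy"
    have \<Phi>: "?\<Phi> = ?F + \<epsilon> *\<^sub>R ?Fy + \<rho>" by (simp add: \<rho>_def)
    have \<rho>: "norm \<rho> \<le> C2 * \<epsilon>\<^sup>2"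
    proof -
      let ?P = "?z + \<epsilon> *\<^sub>R ?a"
      have "norm (?\<Phi> - f ?P) \<le> M * norm ((x, \<Gamma> x) - ?P)" by (rule f_lip)
      also have "\<dots> \<le> M * (C0 * \<epsilon>\<^sup>2)"
        using C0(2)[OF first, of x] M_nonneg by (intro mult_left_mono) (auto simp: diff_diff_eq)
      finally have 1: "norm (?\<Phi> - f ?P) \<le> M * (C0 * \<epsilon>\<^sup>2)" .
      have "norm (f ?P - ?F - Df ?z (\<epsilon> *\<^sub>R ?a)) \<le> M * (norm (\<epsilon> *\<^sub>R ?a))\<^sup>2"
        using f_deriv M_nonneg Df_lip by (rule taylor_order1)
      also have "\<dots> \<le> M * (\<epsilon> * L)\<^sup>2"
        using a eps M_nonneg by (intro mult_left_mono power_mono) auto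
      finally have 2: "norm (f ?P - ?F - \<epsilon> *\<^sub>R ?Fy) \<le> M * (\<epsilon> * L)\<^sup>2" by (simp only: linear_cmul[OF linear_Df])
      have "\<rho> = (?\<Phi> - f ?P) + (f ?P - ?F - \<epsilon> *\<^sub>R ?Fy)" by (simp add: \<rho>_def)
      then have "norm \<rho> \<le> M * (C0 * \<epsilon>\<^sup>2) + M * (\<epsilon> * L)\<^sup>2"
        using 1 2 by (simp only: norm_triangle_le add_mono)
      then show ?thesis by (simp add: C2_def power_mult_distrib algebra_simps)
    qed
    have Fy: "norm ?Fy \<le> M * L"
      using Df_bound[of ?z ?a] mult_left_mono[OF a M_nonneg] by linarith
    \<comment> \<open>The product of \<open>d\<gamma>\<close> + \<epsilon> \<open>d\<gamma>1\<close>
      with \<open>?F\<close> + \<epsilon> \<open>?Fy\<close>, cut off after the first power of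
      \<epsilon>.\<close>
    let ?h = "d\<gamma> x ?F + \<epsilon> *\<^sub>R (d\<gamma> x ?Fy + d\<gamma>1 x ?F)"
    have E: "norm (\<Gamma>' x ?\<Phi> - ?h) \<le> E * \<epsilon>\<^sup>2"
    proof -
      have 1: "norm (\<Gamma>' x ?\<Phi> - d\<gamma> x ?\<Phi> - \<epsilon> *\<^sub>R d\<gamma>1 x ?\<Phi>) \<le> C1' * \<epsilon>\<^sup>2 * M"
        using C1'(2)[OF first \<Gamma>, of x ?\<Phi>] mult_left_mono[OF f_bound[of "(x, \<Gamma> x)"], of "C1' * \<epsilon>\<^sup>2"] C1'(1)
        by (meson mult_nonneg_nonneg order_trans zero_le_power2)
      have 2: "norm (d\<gamma> x \<rho>) \<le> L * (C2 * \<epsilon>\<^sup>2)"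
        using L(2)[of x \<rho>] mult_left_mono[OF \<rho> L(1)] by linarith
      have "norm (\<epsilon> *\<^sub>R ?Fy + \<rho>) \<le> \<epsilon> * (M * L) + C2 * \<epsilon>\<^sup>2"
        using Fy eps \<rho> by (intro norm_triangle_le add_mono) auto
      also have "\<dots> \<le> \<epsilon> * (M * L) + C2 * \<epsilon>" using eps2 C2 by (intro add_left_mono mult_left_mono)
      also have "\<dots> = (M * L + C2) * \<epsilon>" by (simp add: algebra_simps)
      finally have "norm (d\<gamma>1 x (\<epsilon> *\<^sub>R ?Fy + \<rho>)) \<le> L * ((M * L + C2) * \<epsilon>)"
        using L(4)[of x "\<epsilon> *\<^sub>R ?Fy + \<rho>"] mult_left_mono[OF _ L(1)] order_trans by blast
      then have "\<epsilon> * norm (d\<gamma>1 x (\<epsilon> *\<^sub>R ?Fy + \<rho>)) \<le> \<epsilon> * (L * ((M * L + C2) * \<epsilon>))" using eps by simp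
      then have 3: "norm (\<epsilon> *\<^sub>R d\<gamma>1 x (\<epsilon> *\<^sub>R ?Fy + \<rho>)) \<le> \<epsilon> * (L * ((M * L + C2) * \<epsilon>))" using eps by simp
      have "\<Gamma>' x ?\<Phi> - ?h = (\<Gamma>' x ?\<Phi> - d\<gamma> x ?\<Phi> - \<epsilon> *\<^sub>R d\<gamma>1 x ?\<Phi>) + d\<gamma> x \<rho> + \<epsilon> *\<^sub>R d\<gamma>1 x (\<epsilon> *\<^sub>R ?Fy + \<rho>)"
      proof -
        have "d\<gamma> x ?\<Phi> = d\<gamma> x ?F + \<epsilon> *\<^sub>R d\<gamma> x ?Fy + d\<gamma> x \<rho>"
          by (simp only: \<Phi> linear_add[OF linear_d\<gamma>] linear_cmul[OF linear_d\<gamma>])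
        moreover have "d\<gamma>1 x ?\<Phi> = d\<gamma>1 x ?F + d\<gamma>1 x (\<epsilon> *\<^sub>R ?Fy + \<rho>)"
          by (simp only: \<Phi> add.assoc linear_add[OF linear_d\<gamma>1, of _ ?F])
        ultimately show ?thesis by (simp add: scaleR_add_right)
      qed
      also have "norm \<dots> \<le> C1' * \<epsilon>\<^sup>2 * M + L * (C2 * \<epsilon>\<^sup>2) + \<epsilon> * (L * ((M * L + C2) * \<epsilon>))"
        using 1 2 3 by (intro norm_triangle_le add_mono)
      also have "\<dots> = E * \<epsilon>\<^sup>2" by (simp add: E_def power2_eq_square algebra_simps)
      finally show ?thesis .
    qed
    let ?w = "\<epsilon> *\<^sub>R ?a + \<epsilon>\<^sup>2 *\<^sub>R ?b"
    have na: "norm (\<epsilon> *\<^sub>R ?a) \<le> \<epsilon> * L" using a eps by simp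
    have nb: "norm (\<epsilon>\<^sup>2 *\<^sub>R ?b) \<le> \<epsilon>\<^sup>2 * L" using b by (simp add: mult_left_mono)
    have w: "norm ?w \<le> 2 * L * \<epsilon>"
      using norm_triangle_ineq[of "\<epsilon> *\<^sub>R ?a" "\<epsilon>\<^sup>2 *\<^sub>R ?b"] na nb mult_right_mono[OF eps2 L(1)]
      unfolding mult.commute[of "2 * L"] mult.left_commute[of \<epsilon>] by linarith
    have quad: "norm (D2 ?z ?w ?w - \<epsilon>\<^sup>2 *\<^sub>R D2 ?z ?a ?a) \<le> 3 * M * L\<^sup>2 * \<epsilon>^3"
    proof -
      \<comment> \<open>Bilinearity leaves only terms with one slot of order \<epsilon>^2 and the
        other of order \<epsilon>.\<close>
      have "D2 ?z ?w ?w - \<epsilon>\<^sup>2 *\<^sub>R D2 ?z ?a ?a = D2 ?z ?w (\<epsilon>\<^sup>2 *\<^sub>R ?b) + D2 ?z (\<epsilon>\<^sup>2 *\<^sub>R ?b) (\<epsilon> *\<^sub>R ?a)"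
        unfolding linear_add[OF linear_D2_left] linear_add[OF linear_D2_right] linear_cmul[OF linear_D2_left] linear_cmul[OF linear_D2_right]
        by (simp add: power2_eq_square scaleR_add_right)
      also have "norm \<dots> \<le> M * norm ?w * norm (\<epsilon>\<^sup>2 *\<^sub>R ?b) + M * norm (\<epsilon>\<^sup>2 *\<^sub>R ?b) * norm (\<epsilon> *\<^sub>R ?a)"
        by (intro norm_triangle_le add_mono D2_bound)
      also have "\<dots> \<le> M * (2 * L * \<epsilon>) * (\<epsilon>\<^sup>2 * L) + M * (\<epsilon>\<^sup>2 * L) * (\<epsilon> * L)"
        using na nb w M_nonneg L(1) eps by (intro add_mono mult_mono) auto
      also have "\<dots> = 3 * M * L\<^sup>2 * \<epsilon>^3" by (simp add: power2_eq_square power3_eq_cube algebra_simps)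
      finally show ?thesis .
    qed
    have cubic: "norm (g (?z + ?w) - g ?z - D1 ?z ?w - (1/2) *\<^sub>R D2 ?z ?w ?w) \<le> M * (2 * L)^3 * \<epsilon>^3"
    proof -
      have "norm (g (?z + ?w) - g ?z - D1 ?z ?w - (1/2) *\<^sub>R D2 ?z ?w ?w) \<le> M * (norm ?w)^3" by (rule taylor_g2)
      also have "\<dots> \<le> M * (2 * L * \<epsilon>)^3" using w M_nonneg by (intro mult_left_mono power_mono) auto
      finally show ?thesis by (simp add: power_mult_distrib mult_ac)
    qed
    have "norm (g (?z + ?w) - \<epsilon> *\<^sub>R ?h) \<le> R * \<epsilon>^3"
    proof -
      \<comment> \<open>Here both corrector equations act at once: the linear term reproduces the
        target \<open>\<epsilon> *\<^sub>R ?h\<close> together with the negative of the leading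
        quadratic term, which the Taylor formula then cancels.\<close>
      have lin: "D1 ?z ?w = \<epsilon> *\<^sub>R ?h - (1/2) *\<^sub>R \<epsilon>\<^sup>2 *\<^sub>R D2 ?z ?a ?a"
        unfolding linear_add[OF linear_D1] linear_cmul[OF linear_D1] \<gamma>1_eq \<gamma>2_eq
        by (simp add: power2_eq_square algebra_simps)
      have "g (?z + ?w) - \<epsilon> *\<^sub>R ?h = (g (?z + ?w) - g ?z - D1 ?z ?w - (1/2) *\<^sub>R D2 ?z ?w ?w)
          + (1/2) *\<^sub>R (D2 ?z ?w ?w - \<epsilon>\<^sup>2 *\<^sub>R D2 ?z ?a ?a)"
        unfolding lin g_zero scaleR_diff_right by simp
      also have "norm \<dots> \<le> M * (2 * L)^3 * \<epsilon>^3 + (1/2) * (3 * M * L\<^sup>2 * \<epsilon>^3)"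
        using cubic quad by (intro norm_triangle_le add_mono) auto
      also have "\<dots> \<le> M * (2 * L)^3 * \<epsilon>^3 + 2 * M * L\<^sup>2 * \<epsilon>^3"
        using M_nonneg eps by simp
      also have "\<dots> = R * \<epsilon>^3" by (simp add: R_def algebra_simps)
      finally show ?thesis .
    qed
    \<comment> \<open>The factor \<epsilon> of the iteration raises the error of the gradient and of
      \<open>f\<close> from second to third order.\<close>
    moreover have "norm (\<epsilon> *\<^sub>R (\<Gamma>' x ?\<Phi> - ?h)) \<le> E * \<epsilon>^3"
    proof -
      have "\<epsilon> * norm (\<Gamma>' x ?\<Phi> - ?h) \<le> \<epsilon> * (E * \<epsilon>\<^sup>2)" using E eps by simp
      then show ?thesis using eps by (simp add: power2_eq_square power3_eq_cube mult_ac)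
    qed
    moreover have "g (x, \<Gamma>2 x) - g (?z + ?w) = \<epsilon> *\<^sub>R (\<Gamma>' x ?\<Phi> - ?h) - (g (?z + ?w) - \<epsilon> *\<^sub>R ?h)"
      unfolding eq2 scaleR_diff_right by simp
    ultimately have "norm (g (x, \<Gamma>2 x) - g (?z + ?w)) \<le> E * \<epsilon>^3 + R * \<epsilon>^3"
      by (simp only: norm_triangle_le_diff add_mono)
    moreover have "?z + ?w = (x, \<gamma> x + (\<epsilon> *\<^sub>R \<gamma>1 x + \<epsilon>\<^sup>2 *\<^sub>R \<gamma>2 x))" by simp
    ultimately have "norm (\<Gamma>2 x - (\<gamma> x + (\<epsilon> *\<^sub>R \<gamma>1 x + \<epsilon>\<^sup>2 *\<^sub>R \<gamma>2 x))) \<le> (E * \<epsilon>^3 + R * \<epsilon>^3) / \<beta>"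
      by (simp only: norm_le_g)
    then show "norm (\<Gamma>2 x - \<gamma> x - \<epsilon> *\<^sub>R \<gamma>1 x - \<epsilon>\<^sup>2 *\<^sub>R \<gamma>2 x) \<le> (E + R) / \<beta> * \<epsilon>^3"
      by (simp add: diff_diff_eq algebra_simps)
  qed
qed

end

section \<open>Iterated partial derivatives and Sobolev norms\<close>

lemma finite_basis_lists: "finite (basis_lists j :: 'a::euclidean_space list set)"
  unfolding basis_lists_def by (rule finite_subset[OF _ finite_lists_length_eq[OF finite_Basis, of j]]) auto

lemma basis_lists_0: "basis_lists 0 = {[]}"
  by (auto simp: basis_lists_def)

lemma Cons_in_basis_lists: "v # vs \<in> basis_lists (Suc j) \<longleftrightarrow> v \<in> Basis \<and> vs \<in> basis_lists j"
  by (auto simp: basis_lists_def)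

lemma snoc_in_basis_lists: "vs @ [v] \<in> basis_lists (Suc j) \<longleftrightarrow> v \<in> Basis \<and> vs \<in> basis_lists j"
  by (auto simp: basis_lists_def)

text \<open>The recursion peels off the outermost derivative at the head of the list; the innermost
  one sits at the end. This exchanges \<open>h\<close> for one of its partial derivatives.\<close>

lemma iter_deriv_snoc: "iter_deriv h (vs @ [b]) = iter_deriv (\<lambda>z. frechet_derivative h (at z) b) vs"
  by (induction vs) simp_all

lemma C_class_differentiable:
  assumes "C_class k h" "vs \<in> basis_lists j" "j < k"
  shows "iter_deriv h vs differentiable (at z)"
  using assms by (auto simp: C_class_def)

lemma C_class_continuous:
  assumes "C_class k h" "vs \<in> basis_lists j" "j \<le> k"
  shows "continuous_on UNIV (iter_deriv h vs)"
  using assms by (auto simp: C_class_def)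

lemma C_class_mono:
  assumes "C_class k h" "m \<le> k"
  shows "C_class m h"
  unfolding C_class_def
  using C_class_differentiable[OF assms(1)] C_class_continuous[OF assms(1)] assms(2) by simp

lemma C_class_Suc_partial:
  assumes "C_class (Suc k) h" "b \<in> Basis"
  shows "C_class k (\<lambda>z. frechet_derivative h (at z) b)"
  unfolding C_class_def
proof (intro conjI allI impI ballI)
  fix j :: nat and vs :: "'a list" and z assume "j < k" "vs \<in> basis_lists j"
  then show "iter_deriv (\<lambda>z. frechet_derivative h (at z) b) vs differentiable at z"
    using C_class_differentiable[OF assms(1), of "vs @ [b]" "Suc j"] assms(2)
    by (simp add: iter_deriv_snoc snoc_in_basis_lists)
next
  fix j :: nat and vs :: "'a list" assume "j \<le> k" "vs \<in> basis_lists j"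
  then show "continuous_on UNIV (iter_deriv (\<lambda>z. frechet_derivative h (at z) b) vs)"
    using C_class_continuous[OF assms(1), of "vs @ [b]" "Suc j"] assms(2)
    by (simp add: iter_deriv_snoc snoc_in_basis_lists)
qed

lemma C_class_Suc_has_derivative:
  assumes "C_class (Suc k) h"
  shows "(h has_derivative frechet_derivative h (at z)) (at z)"
  using C_class_differentiable[OF assms, of "[]" 0] by (simp add: basis_lists_0 frechet_derivative_works)

text \<open>Carries derivatives between \<open>g\<close> and its full gradient in both directions,
  since partial derivatives and full gradient are obtained from each other by constant linear
  maps.\<close>

lemma iter_deriv_bounded_linear:
  assumes "bounded_linear L" "C_class k h" "j \<le> k" "vs \<in> basis_lists j"
  shows "iter_deriv (\<lambda>z. L (h z)) vs = (\<lambda>z. L (iter_deriv h vs z))"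
  using assms(3,4)
proof (induction vs arbitrary: j)
  case (Cons v vs)
  then obtain i where i: "j = Suc i" by (cases j) (auto simp: basis_lists_0)
  then have vs: "vs \<in> basis_lists i" using Cons.prems by (simp add: Cons_in_basis_lists)
  show ?case
  proof
    fix z
    have "(iter_deriv h vs has_derivative frechet_derivative (iter_deriv h vs) (at z)) (at z)"
      using C_class_differentiable[OF assms(2) vs] i Cons.prems(1) by (simp add: frechet_derivative_works)
    from bounded_linear.has_derivative[OF assms(1) this]
    have "frechet_derivative (\<lambda>z. L (iter_deriv h vs z)) (at z) = (\<lambda>v. L (frechet_derivative (iter_deriv h vs) (at z) v))"
      using frechet_derivative_at by metis
    then show "iter_deriv (\<lambda>z. L (h z)) (v # vs) z = L (iter_deriv h (v # vs) z)"
      using Cons.IH[OF _ vs] i Cons.prems(1) by simp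
  qed
qed simp

lemma C_class_bounded_linear:
  fixes h :: "'a::euclidean_space \<Rightarrow> 'b::euclidean_space" and L :: "'b \<Rightarrow> 'c::euclidean_space"
  assumes "bounded_linear L" "C_class k h"
  shows "C_class k (\<lambda>z. L (h z))"
  unfolding C_class_def
proof (intro conjI allI impI ballI)
  fix j :: nat and vs :: "'a list" and z assume j: "j < k" and vs: "vs \<in> basis_lists j"
  have "(\<lambda>z. L (iter_deriv h vs z)) differentiable at z"
    using bounded_linear.has_derivative[OF assms(1)] C_class_differentiable[OF assms(2) vs j]
    unfolding differentiable_def by blast
  then show "iter_deriv (\<lambda>z. L (h z)) vs differentiable at z"
    using iter_deriv_bounded_linear[OF assms _ vs] j by simp
next
  fix j :: nat and vs :: "'a list" assume j: "j \<le> k" and vs: "vs \<in> basis_lists j"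
  show "continuous_on UNIV (iter_deriv (\<lambda>z. L (h z)) vs)"
    unfolding iter_deriv_bounded_linear[OF assms j vs]
    by (rule bounded_linear.continuous_on[OF assms(1) C_class_continuous[OF assms(2) vs j]])
qed

lemma iter_deriv_sum:
  assumes "finite I" "\<And>i. i \<in> I \<Longrightarrow> C_class k (h i)" "j \<le> k" "vs \<in> basis_lists j"
  shows "iter_deriv (\<lambda>z. \<Sum>i\<in>I. h i z) vs = (\<lambda>z. \<Sum>i\<in>I. iter_deriv (h i) vs z)"
  using assms(3,4)
proof (induction vs arbitrary: j)
  case (Cons v vs)
  then obtain l where l: "j = Suc l" by (cases j) (auto simp: basis_lists_0)
  then have vs: "vs \<in> basis_lists l" using Cons.prems by (simp add: Cons_in_basis_lists)
  show ?case
  proof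
    fix z
    have "(iter_deriv (h i) vs has_derivative frechet_derivative (iter_deriv (h i) vs) (at z)) (at z)" if "i \<in> I" for i
      using C_class_differentiable[OF assms(2)[OF that] vs] l Cons.prems(1) by (simp add: frechet_derivative_works)
    then have "((\<lambda>z. \<Sum>i\<in>I. iter_deriv (h i) vs z) has_derivative
       (\<lambda>v. \<Sum>i\<in>I. frechet_derivative (iter_deriv (h i) vs) (at z) v)) (at z)"
      by (rule has_derivative_sum)
    then have "frechet_derivative (\<lambda>z. \<Sum>i\<in>I. iter_deriv (h i) vs z) (at z)
        = (\<lambda>v. \<Sum>i\<in>I. frechet_derivative (iter_deriv (h i) vs) (at z) v)"
      using frechet_derivative_at by metis
    then show "iter_deriv (\<lambda>z. \<Sum>i\<in>I. h i z) (v # vs) z = (\<Sum>i\<in>I. iter_deriv (h i) (v # vs) z)"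
      using Cons.IH[OF _ vs] l Cons.prems(1) by simp
  qed
qed simp

lemma C_class_sum:
  fixes h :: "'i \<Rightarrow> 'a::euclidean_space \<Rightarrow> 'b::euclidean_space"
  assumes "finite I" "\<And>i. i \<in> I \<Longrightarrow> C_class k (h i)"
  shows "C_class k (\<lambda>z. \<Sum>i\<in>I. h i z)"
  unfolding C_class_def
proof (intro conjI allI impI ballI)
  fix j :: nat and vs :: "'a list" and z assume j: "j < k" and vs: "vs \<in> basis_lists j"
  have "(\<lambda>z. \<Sum>i\<in>I. iter_deriv (h i) vs z) differentiable at z"
    using C_class_differentiable[OF assms(2) vs j] assms(1) by (intro differentiable_sum) auto
  then show "iter_deriv (\<lambda>z. \<Sum>i\<in>I. h i z) vs differentiable at z"
    using iter_deriv_sum[OF assms _ vs] j by simp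
next
  fix j :: nat and vs :: "'a list" assume j: "j \<le> k" and vs: "vs \<in> basis_lists j"
  show "continuous_on UNIV (iter_deriv (\<lambda>z. \<Sum>i\<in>I. h i z) vs)"
  proof -
    have "iter_deriv (\<lambda>z. \<Sum>i\<in>I. h i z) vs = (\<lambda>z. \<Sum>i\<in>I. iter_deriv (h i) vs z)"
      by (rule iter_deriv_sum[OF assms j vs])
    moreover have "continuous_on UNIV (\<lambda>z. \<Sum>i\<in>I. iter_deriv (h i) vs z)"
      using C_class_continuous[OF assms(2) vs j] by (rule continuous_on_sum)
    ultimately show ?thesis by (simp only:)
  qed
qed

section \<open>Sobolev norms of functions with continuous derivatives\<close>

lemma continuous_on_nabla_norm:
  assumes "\<And>vs. vs \<in> basis_lists j \<Longrightarrow> continuous_on UNIV (iter_deriv h vs)"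
  shows "continuous_on UNIV (nabla_norm j h)"
  unfolding nabla_norm_def using assms by (intro continuous_intros) auto

lemma nabla_norm_measurable:
  assumes "\<And>vs. vs \<in> basis_lists j \<Longrightarrow> continuous_on UNIV (iter_deriv h vs)"
  shows "(\<lambda>z. ereal (nabla_norm j h z)) \<in> borel_measurable lebesgue"
proof -
  have "nabla_norm j h \<in> borel_measurable borel"
    using continuous_on_nabla_norm[OF assms] by (rule borel_measurable_continuous_onI)
  then have "nabla_norm j h \<in> borel_measurable lborel" by simp
  then have "nabla_norm j h \<in> borel_measurable lebesgue" by (rule measurable_completion)
  then show ?thesis by (rule borel_measurable_ereal)
qed

lemma norm_iter_deriv_le_nabla_norm:
  assumes "vs \<in> basis_lists j"
  shows "norm (iter_deriv h vs z) \<le> nabla_norm j h z"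
  unfolding nabla_norm_def
  by (rule real_le_rsqrt, rule member_le_sum[OF assms]) (simp_all add: finite_basis_lists)

text \<open>An essential bound on a continuous function holds everywhere: the set where it fails is
  open and null, hence empty.\<close>

lemma C_class_W_norm_bounded:
  assumes C: "C_class k h" and W: "W_norm k h < \<infinity>" and "j \<le> k"
  obtains M where "M \<ge> 0" "\<And>vs z. vs \<in> basis_lists j \<Longrightarrow> norm (iter_deriv h vs z) \<le> M"
proof -
  let ?N = "\<lambda>z. ereal (nabla_norm j h z)" and ?e = "esssup lebesgue (\<lambda>z. ereal (nabla_norm j h z))"
  have cont: "continuous_on UNIV (nabla_norm j h)"
    using C_class_continuous[OF C _ \<open>j \<le> k\<close>] by (rule continuous_on_nabla_norm)
  have "?e \<le> W_norm k h"
    unfolding W_norm_def using \<open>j \<le> k\<close> by (intro Max_ge) auto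
  then have "?e < \<infinity>" using W by (rule order_le_less_trans)
  then obtain c where c: "?e \<le> ereal c" "c \<ge> 0"
  \<comment> \<open>Plus infinity is excluded by the norm hypothesis; for minus infinity the value 0
    serves as bound.\<close>
  proof (cases ?e)
    case (real r)
    then show thesis by (intro that[of "max r 0"]) auto
  qed (use that[of 0] in auto)
  have AE: "AE z in lebesgue. nabla_norm j h z \<le> c"
    using esssup_AE[of ?N lebesgue]
  proof eventually_elim
    case (elim z)
    then have "ereal (nabla_norm j h z) \<le> ereal c" using c(1) by (rule order_trans)
    then show ?case by simp
  qed
  let ?U = "{z. nabla_norm j h z > c}"
  have "open ?U" using cont by (intro open_Collect_less continuous_intros)
  have "?U \<in> sets lebesgue" using \<open>open ?U\<close> borel_open by auto
  then have "?U \<in> null_sets lebesgue"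
    using AE by (subst AE_iff_null_sets) (auto simp: not_less)
  then have "negligible ?U" by (simp add: negligible_iff_null_sets)
  with \<open>open ?U\<close> have "?U = {}" using open_not_negligible by blast
  then have "nabla_norm j h z \<le> c" for z by (simp add: not_less[symmetric])
  then show thesis
    using that[OF c(2)] norm_iter_deriv_le_nabla_norm order_trans by blast
qed

text \<open>Continuity of the iterated derivatives supplies the measurability under which a
  pointwise bound passes to the essential supremum.\<close>

lemma W_norm_leI:
  assumes "\<And>j vs. j \<le> k \<Longrightarrow> vs \<in> basis_lists j \<Longrightarrow> continuous_on UNIV (iter_deriv h vs)"
    and "\<And>j z. j \<le> k \<Longrightarrow> nabla_norm j h z \<le> c"
  shows "W_norm k h \<le> ereal c"
proof -
  have "esssup lebesgue (\<lambda>z. ereal (nabla_norm j h z)) \<le> ereal c" if "j \<le> k" for j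
    using assms that by (intro esssup_I nabla_norm_measurable) auto
  then show ?thesis unfolding W_norm_def by (subst Max_le_iff) auto
qed

lemma nabla_norm_0: "nabla_norm 0 h z = norm (h z)"
  by (simp add: nabla_norm_def basis_lists_0)

lemma nabla_norm_1_le:
  fixes h :: "'a::euclidean_space \<Rightarrow> 'b::euclidean_space"
  assumes "\<And>b. b \<in> Basis \<Longrightarrow> norm (frechet_derivative h (at z) b) \<le> c"
  shows "nabla_norm 1 h z \<le> real (DIM('a)) * c"
proof -
  have bl: "basis_lists 1 = (\<lambda>b. [b]) ` (Basis :: 'a set)"
    by (auto simp: basis_lists_def length_Suc_conv)
  have "nabla_norm 1 h z = L2_set (\<lambda>b. norm (frechet_derivative h (at z) b)) (Basis :: 'a set)"
    unfolding nabla_norm_def L2_set_def bl by (subst sum.reindex) (auto simp: inj_on_def)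
  also have "\<dots> \<le> (\<Sum>b\<in>Basis. norm (frechet_derivative h (at z) b))" by (rule L2_set_le_sum) simp
  also have "\<dots> \<le> (\<Sum>b\<in>(Basis :: 'a set). c)" using assms by (rule sum_mono)
  finally show ?thesis by simp
qed

lemma W_norm_0_le:
  assumes "continuous_on UNIV h" "\<And>z. norm (h z) \<le> c"
  shows "W_norm 0 h \<le> ereal c"
  using assms by (intro W_norm_leI) (auto simp: basis_lists_0 nabla_norm_0)

lemma W_norm_1_le:
  fixes h :: "'a::euclidean_space \<Rightarrow> 'b::euclidean_space"
  assumes h: "C1 h h'" and h_le: "\<And>z. norm (h z) \<le> c" and h'_le: "\<And>z v. norm (h' z v) \<le> c * norm v"
  shows "W_norm 1 h \<le> ereal (real (DIM('a)) * c)"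
proof (rule W_norm_leI)
  have h': "frechet_derivative h (at z) = h' z" for z
    using frechet_derivative_at[OF C1D(1)[OF h]] by simp
  fix j :: nat assume "j \<le> 1"
  then consider "j = 0" | "j = 1" by linarith
  note cases = this
  show "continuous_on UNIV (iter_deriv h vs)" if "vs \<in> basis_lists j" for vs
    using cases
  proof cases
    case 1
    with that C1_continuous[OF h] show ?thesis by (simp add: basis_lists_0)
  next
    case 2
    with that obtain b where "vs = [b]" by (auto simp: basis_lists_def length_Suc_conv)
    then show ?thesis using C1_continuous_derivative[OF h continuous_on_id continuous_on_const] by (simp add: h')
  qed
  show "nabla_norm j h z \<le> real (DIM('a)) * c" for z
    using cases
  proof cases
    case 1
    \<comment> \<open>The factor for first-order derivatives also covers order zero, as the
      dimension is at least 1 and \<open>c\<close> dominates a norm.\<close>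
    have "1 * c \<le> real (DIM('a)) * c"
      using order_trans[OF norm_ge_zero h_le] DIM_positive[where 'a='a] by (intro mult_right_mono) (auto simp: Suc_le_eq)
    with 1 h_le[of z] show ?thesis by (simp add: nabla_norm_0)
  next
    case 2
    have "norm (frechet_derivative h (at z) b) \<le> c" if "b \<in> Basis" for b
      using h'_le[of z b] that by (simp add: h')
    then show ?thesis unfolding 2 by (rule nabla_norm_1_le)
  qed
qed

section \<open>From basis directions to arbitrary directions\<close>

lemma norm_linear_le_Basis:
  fixes L :: "'a::euclidean_space \<Rightarrow> 'b::real_normed_vector"
  assumes "linear L" "\<And>b. b \<in> Basis \<Longrightarrow> norm (L b) \<le> B"
  shows "norm (L v) \<le> real (DIM('a)) * B * norm v"
proof -
  have "norm (L v) \<le> (\<Sum>b\<in>(Basis :: 'a set). norm v * B)"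
    unfolding linear_eq_sum_Basis[OF assms(1), of v]
  proof (rule sum_norm_le)
    show "norm ((v \<bullet> b) *\<^sub>R L b) \<le> norm v * B" if "b \<in> Basis" for b
      unfolding norm_scaleR using assms(2)[OF that] Basis_le_norm[OF that] by (intro mult_mono) auto
  qed
  then show ?thesis by (simp add: mult_ac)
qed

text \<open>Each slot filled by an arbitrary vector in place of a basis vector costs one factor of
  the dimension. The Lipschitz bound on the second derivative has three such slots, so the cube
  dominates all constants that occur.\<close>

lemma le_DIM_cubed_mult:
  fixes B :: real
  assumes "B \<ge> 0"
  defines "n \<equiv> real (DIM('a::euclidean_space))"
  shows "B \<le> n^3 * B" "n * B \<le> n^3 * B" "n * (n * B) \<le> n^3 * B"
proof -
  have n: "1 \<le> n" using DIM_positive[where 'a='a] by (simp add: n_def Suc_le_eq)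
  have "n^i * B \<le> n^3 * B" if "i \<le> 3" for i
    using power_increasing[OF that n] assms(1) by (rule mult_right_mono)
  from this[of 0] this[of 1] this[of 2]
  show "B \<le> n^3 * B" "n * B \<le> n^3 * B" "n * (n * B) \<le> n^3 * B"
    by (simp_all add: power2_eq_square mult.assoc)
qed

lemma iter_deriv_lipschitz:
  assumes "C_class k h" "vs \<in> basis_lists j" "j < k"
    and "\<And>us z. us \<in> basis_lists (Suc j) \<Longrightarrow> norm (iter_deriv h us z) \<le> B"
  shows "norm (iter_deriv h vs z' - iter_deriv h vs z) \<le> real (DIM('a::euclidean_space)) * B * norm (z' - (z :: 'a))"
proof (rule lipschitz_of_derivative_bound)
  fix z :: 'a
  show "(iter_deriv h vs has_derivative frechet_derivative (iter_deriv h vs) (at z)) (at z)"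
    using C_class_differentiable[OF assms(1-3)] by (simp add: frechet_derivative_works)
  then have lin: "linear (frechet_derivative (iter_deriv h vs) (at z))" by (rule has_derivative_linear)
  show "norm (frechet_derivative (iter_deriv h vs) (at z) v) \<le> real (DIM('a)) * B * norm v" for v
    using assms(4)[of "_ # vs"] assms(2) by (intro norm_linear_le_Basis[OF lin]) (simp add: Cons_in_basis_lists)
qed

lemma singleton_in_basis_lists: "[b] \<in> basis_lists (Suc 0) \<longleftrightarrow> b \<in> Basis"
  by (auto simp: basis_lists_def)

lemma pair_in_basis_lists: "[c, b] \<in> basis_lists (Suc (Suc 0)) \<longleftrightarrow> c \<in> Basis \<and> b \<in> Basis"
  by (auto simp: basis_lists_def)

lemma frechet_derivative_lipschitz:
  fixes h :: "'a::euclidean_space \<Rightarrow> 'b::euclidean_space"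
  assumes C: "C_class (Suc (Suc k)) h"
    and B: "\<And>us z. us \<in> basis_lists (Suc (Suc 0)) \<Longrightarrow> norm (iter_deriv h us z) \<le> B"
  shows "norm (frechet_derivative h (at z') v - frechet_derivative h (at z) v)
    \<le> real (DIM('a)) * (real (DIM('a)) * B) * norm (z' - z) * norm v"
proof -
  let ?n = "real (DIM('a))"
  let ?L = "\<lambda>v. frechet_derivative h (at z') v - frechet_derivative h (at z) v"
  have "norm (?L v) \<le> ?n * (?n * B * norm (z' - z)) * norm v"
  proof (rule norm_linear_le_Basis)
    show "linear ?L"
      by (intro linear_compose_sub has_derivative_linear[OF C_class_Suc_has_derivative[OF C]])
    show "norm (?L b) \<le> ?n * B * norm (z' - z)" if "b \<in> Basis" for b
      using iter_deriv_lipschitz[OF C, of "[b]" "Suc 0" B z' z] B that by (simp add: singleton_in_basis_lists)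
  qed
  then show ?thesis by (simp add: mult_ac)
qed

text \<open>The bounds start at order 1 because an expanding \<open>g\<close> cannot itself be
  bounded. Bounds on third derivatives along basis vectors become the Lipschitz bound on the second
  derivative.\<close>

lemma C_class_bounded_C21:
  fixes h :: "'a::euclidean_space \<Rightarrow> 'b::euclidean_space"
  assumes C: "C_class (Suc (Suc (Suc k))) h" and "B \<ge> 0"
    and B: "\<And>j us z. j \<in> {1, 2, 3} \<Longrightarrow> us \<in> basis_lists j \<Longrightarrow> norm (iter_deriv h us z) \<le> B"
  shows "bounded_C21 h (\<lambda>z. frechet_derivative h (at z))
    (\<lambda>z v. frechet_derivative (\<lambda>z. frechet_derivative h (at z) v) (at z)) (real (DIM('a))^3 * B)"
proof -
  let ?n = "real (DIM('a))" and ?D1 = "\<lambda>z. frechet_derivative h (at z)"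
  let ?D2 = "\<lambda>z v. frechet_derivative (\<lambda>z. frechet_derivative h (at z) v) (at z)"
  have deriv: "(h has_derivative ?D1 z) (at z)" for z
    using C by (rule C_class_Suc_has_derivative)
  have lin: "linear (?D1 z)" for z using deriv by (rule has_derivative_linear)
  have partial: "((\<lambda>z. ?D1 z b) has_derivative ?D2 z b) (at z)" if "b \<in> Basis" for b z
    using C_class_Suc_partial[OF C that] by (rule C_class_Suc_has_derivative)
  \<comment> \<open>\<open>C_class\<close> speaks of basis directions only; linearity of the first
    derivative carries the second derivative over to every \<open>v\<close>.\<close>
  have expand: "((\<lambda>z. ?D1 z v) has_derivative (\<lambda>w. \<Sum>b\<in>Basis. (v \<bullet> b) *\<^sub>R ?D2 z b w)) (at z)" for z v
  proof -
    have "((\<lambda>z. \<Sum>b\<in>Basis. (v \<bullet> b) *\<^sub>R ?D1 z b) has_derivative (\<lambda>w. \<Sum>b\<in>Basis. (v \<bullet> b) *\<^sub>R ?D2 z b w)) (at z)"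
      by (intro has_derivative_sum has_derivative_scaleR_right partial)
    then show ?thesis by (simp only: linear_eq_sum_Basis[OF lin, symmetric])
  qed
  have D2_eq: "?D2 z v w = (\<Sum>b\<in>Basis. (v \<bullet> b) *\<^sub>R ?D2 z b w)" for z v w
    by (rule fun_cong[OF frechet_derivative_at[OF expand, symmetric]])
  have D1_deriv: "((\<lambda>z. ?D1 z v) has_derivative ?D2 z v) (at z)" for z v
    using differentiableI[OF expand] unfolding frechet_derivative_works .
  have linD2: "linear (\<lambda>v. ?D2 z v w)" for z w
  proof -
    have "linear (\<lambda>v. \<Sum>b\<in>Basis. (v \<bullet> b) *\<^sub>R ?D2 z b w)"
      by (rule linearI) (simp_all add: inner_add_left scaleR_add_left sum.distrib scaleR_sum_right)
    then show ?thesis by (simp only: D2_eq[symmetric])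
  qed
  have D1_le: "norm (?D1 z v) \<le> ?n * B * norm v" for z v
    using B[of 1 "[_]"] by (intro norm_linear_le_Basis lin) (simp add: singleton_in_basis_lists)
  have D2_le: "norm (?D2 z v w) \<le> ?n * (?n * B * norm w) * norm v" for z v w
  proof (rule norm_linear_le_Basis[OF linD2])
    show "norm (?D2 z b w) \<le> ?n * B * norm w" if "b \<in> Basis" for b
      using B[of 2 "[_, b]"] that
      by (intro norm_linear_le_Basis has_derivative_linear[OF partial]) (auto simp: pair_in_basis_lists numeral_2_eq_2)
  qed
  have D2_lip: "norm (?D2 z' v w - ?D2 z v w) \<le> ?n * (?n * (?n * B) * norm (z' - z) * norm w) * norm v" for z z' v w
  proof (rule norm_linear_le_Basis[OF linear_compose_sub[OF linD2 linD2]])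
    show "norm (?D2 z' b w - ?D2 z b w) \<le> ?n * (?n * B) * norm (z' - z) * norm w" if "b \<in> Basis" for b
    proof (rule frechet_derivative_lipschitz)
      show "C_class (Suc (Suc k)) (\<lambda>z. ?D1 z b)" using C that by (rule C_class_Suc_partial)
      show "norm (iter_deriv (\<lambda>z. ?D1 z b) us z) \<le> B" if "us \<in> basis_lists (Suc (Suc 0))" for us z
        using B[of 3 "us @ [b]" z] that \<open>b \<in> Basis\<close>
        by (simp add: iter_deriv_snoc snoc_in_basis_lists numeral_3_eq_3)
    qed
  qed
  note pow = le_DIM_cubed_mult(2,3)[where 'a='a, OF \<open>B \<ge> 0\<close>]
  show ?thesis
  proof
    show "norm (?D1 z v) \<le> ?n^3 * B * norm v" for z v
      by (rule order_trans[OF D1_le mult_right_mono[OF pow(1)]]) simp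
    show "norm (?D2 z v w) \<le> ?n^3 * B * norm v * norm w" for z v w
    proof -
      have "norm (?D2 z v w) \<le> ?n * (?n * B) * (norm v * norm w)" using D2_le[where z=z and v=v and w=w] by (simp add: mult_ac)
      also have "\<dots> \<le> ?n^3 * B * (norm v * norm w)" by (rule mult_right_mono[OF pow(2)]) simp
      finally show ?thesis by (simp add: mult_ac)
    qed
    show "norm (?D2 z' v w - ?D2 z v w) \<le> ?n^3 * B * norm (z' - z) * norm v * norm w" for z z' v w
      using D2_lip[where z=z and z'=z' and v=v and w=w] by (simp add: mult_ac power3_eq_cube)
  qed (use deriv D1_deriv \<open>B \<ge> 0\<close> in auto)
qed

section \<open>Matrices and the full gradient\<close>

lemma jacobian_mult:
  fixes h :: "real^'n \<Rightarrow> real^'m"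
  assumes "h differentiable (at x)"
  shows "jacobian h (at x) *v u = frechet_derivative h (at x) u"
  using frechet_derivative_at[OF assms[unfolded jacobian_works]] by (rule fun_cong)

lemma has_derivative_left_section:
  assumes "(h has_derivative h') (at (x, y))"
  shows "((\<lambda>x. h (x, y)) has_derivative (\<lambda>u. h' (u, 0))) (at x)"
  by (rule has_derivative_compose[where f="\<lambda>x. (x, y)" and g=h, OF _ assms]) (auto intro!: derivative_eq_intros)

lemma has_derivative_right_section:
  assumes "(h has_derivative h') (at (x, y))"
  shows "((\<lambda>y. h (x, y)) has_derivative (\<lambda>w. h' (0, w))) (at y)"
  by (rule has_derivative_compose[where f="\<lambda>y. (x, y)" and g=h, OF _ assms]) (auto intro!: derivative_eq_intros)

lemma full_grad_mult:
  assumes h: "(h has_derivative h') (at z)"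
  shows "h' b = fst (full_grad h z) *v fst b + snd (full_grad h z) *v snd b"
proof -
  obtain x y where z: "z = (x, y)" by fastforce
  have l: "jacobian (\<lambda>x'. h (x', y)) (at x) *v u = h' (u, 0)" for u
    using has_derivative_left_section[OF h[unfolded z]] 
    by (simp add: jacobian_mult differentiableI frechet_derivative_at[symmetric])
  have r: "jacobian (\<lambda>y'. h (x, y')) (at y) *v w = h' (0, w)" for w
    using has_derivative_right_section[OF h[unfolded z]] 
    by (simp add: jacobian_mult differentiableI frechet_derivative_at[symmetric])
  have "h' b = h' (fst b, 0) + h' (0, snd b)"
    using linear_add[OF has_derivative_linear[OF h], of "(fst b, 0)" "(0, snd b)"] by simp
  then show ?thesis by (simp add: full_grad_def z l r)
qed

text \<open>Exhibits the full gradient as a finite sum of fixed linear images of the partial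
  derivatives, the form in which smoothness is inherited.\<close>

lemma full_grad_eq_sum:
  assumes h: "(h has_derivative h') (at z)"
  shows "full_grad h z = (\<Sum>b\<in>Basis. ((\<chi> i j. h' b $ i * fst b $ j), (\<chi> i j. h' b $ i * snd b $ j)))"
proof -
  have lin: "linear h'" using h by (rule has_derivative_linear)
  have "fst (full_grad h z) $ i $ j = h' (axis j 1, 0) $ i" for i j
    using full_grad_mult[OF h, of "(axis j 1, 0)"] by (simp add: matrix_vector_mul_component inner_axis)
  moreover have "snd (full_grad h z) $ i $ j = h' (0, axis j 1) $ i" for i j
    using full_grad_mult[OF h, of "(0, axis j 1)"] by (simp add: matrix_vector_mul_component inner_axis)
  ultimately show ?thesis
    by (auto simp: prod_eq_iff vec_eq_iff fst_sum snd_sum sum_component inner_axis' inner_prod_def mult.commute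
        linear_eq_sum_Basis[OF lin, of "(axis _ 1, 0)"] linear_eq_sum_Basis[OF lin, of "(0, axis _ 1)"])
qed

lemma C_class_full_grad:
  fixes h :: "(real^'nx) \<times> (real^'ny) \<Rightarrow> real^'m"
  assumes "C_class (Suc k) h"
  shows "C_class k (full_grad h)"
proof -
  let ?E = "\<lambda>(b :: (real^'nx) \<times> (real^'ny)) (w :: real^'m). ((\<chi> i j. w $ i * fst b $ j), (\<chi> i j. w $ i * snd b $ j))"
  have E: "bounded_linear (?E b)" for b
    unfolding linear_conv_bounded_linear[symmetric]
    by (rule linearI) (auto simp: vec_eq_iff algebra_simps)
  have "full_grad h = (\<lambda>z. \<Sum>b\<in>Basis. ?E b (frechet_derivative h (at z) b))"
    using full_grad_eq_sum[OF C_class_Suc_has_derivative[OF assms]] by auto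
  moreover have "C_class k (\<lambda>z. \<Sum>b\<in>Basis. ?E b (frechet_derivative h (at z) b))"
    using C_class_bounded_linear[OF E C_class_Suc_partial[OF assms]] by (intro C_class_sum) auto
  ultimately show ?thesis by simp
qed

text \<open>The innermost derivative along \<open>b\<close> is a fixed linear image of the full
  gradient, so order \<open>Suc j\<close> of \<open>h\<close> is controlled by order
  \<open>j\<close> of the gradient.\<close>

lemma iter_deriv_bounded_of_full_grad:
  fixes h :: "(real^'nx) \<times> (real^'ny) \<Rightarrow> real^'m"
  assumes C: "C_class (Suc k) h" and W: "W_norm k (full_grad h) < \<infinity>" and j: "j \<le> k"
  obtains M where "M \<ge> 0" "\<And>vs z. vs \<in> basis_lists (Suc j) \<Longrightarrow> norm (iter_deriv h vs z) \<le> M"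
proof -
  let ?L = "\<lambda>b (X :: (real^'nx^'m) \<times> (real^'ny^'m)). fst X *v fst b + snd X *v snd b"
  have L: "bounded_linear (?L b)" for b
    unfolding linear_conv_bounded_linear[symmetric]
    by (rule linearI) (simp_all add: matrix_vector_mult_add_rdistrib scaleR_matrix_vector_assoc scaleR_add_right)
  then have "\<exists>K\<ge>0. \<forall>X. norm (?L b X) \<le> norm X * K" for b
    using bounded_linear.nonneg_bounded by blast
  then obtain K where K: "\<And>b. K b \<ge> 0" "\<And>b X. norm (?L b X) \<le> norm X * K b" by metis
  obtain M where M: "M \<ge> 0" "\<And>vs z. vs \<in> basis_lists j \<Longrightarrow> norm (iter_deriv (full_grad h) vs z) \<le> M"
    using C_class_W_norm_bounded[OF C_class_full_grad[OF C] W j] by blast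
  show thesis
  proof (rule that[of "M * (\<Sum>b\<in>Basis. K b)"])
    show "M * (\<Sum>b\<in>Basis. K b) \<ge> 0" using M(1) K(1) by (simp add: sum_nonneg)
    fix us :: "((real^'nx) \<times> (real^'ny)) list" and z assume us: "us \<in> basis_lists (Suc j)"
    then obtain vs b where us_eq: "us = vs @ [b]" by (cases us rule: rev_cases) (auto simp: basis_lists_def)
    with us have b: "b \<in> Basis" and vs: "vs \<in> basis_lists j" by (auto simp: snoc_in_basis_lists)
    have "(\<lambda>z. frechet_derivative h (at z) b) = (\<lambda>z. ?L b (full_grad h z))"
      using full_grad_mult[OF C_class_Suc_has_derivative[OF C]] by auto
    then have "iter_deriv h us z = ?L b (iter_deriv (full_grad h) vs z)"
      using iter_deriv_bounded_linear[OF L C_class_full_grad[OF C] j vs, of b] by (simp add: us_eq iter_deriv_snoc)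
    then have "norm (iter_deriv h us z) \<le> norm (iter_deriv (full_grad h) vs z) * K b" using K(2) by metis
    also have "\<dots> \<le> M * (\<Sum>b\<in>Basis. K b)"
      using M(2)[OF vs] K(1) M(1) b by (intro mult_mono member_le_sum) auto
    finally show "norm (iter_deriv h us z) \<le> M * (\<Sum>b\<in>Basis. K b)" .
  qed
qed

text \<open>The estimates bound the action on vectors, whereas the gradient claim concerns the
  Euclidean norm of the matrix; the dimensional factors are the price of passing through
  entries.\<close>

lemma norm_matrix_le:
  fixes A :: "real^'n^'m"
  assumes "\<And>u. norm (A *v u) \<le> c * norm u"
  shows "norm A \<le> real CARD('m) * (real CARD('n) * c)"
proof -
  have entry: "\<bar>A $ i $ j\<bar> \<le> c" for i j
  proof -
    have "A $ i $ j = (A *v axis j 1) $ i" by (simp add: matrix_vector_mul_component inner_axis)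
    also have "\<bar>\<dots>\<bar> \<le> norm (A *v axis j 1)" by (rule component_le_norm_cart)
    also have "\<dots> \<le> c" using assms[of "axis j 1"] by simp
    finally show ?thesis .
  qed
  have "norm A \<le> (\<Sum>i\<in>UNIV. norm (A $ i))" unfolding norm_vec_def by (rule L2_set_le_sum) simp
  also have "\<dots> \<le> (\<Sum>i\<in>(UNIV::'m set). real CARD('n) * c)"
  proof (rule sum_mono)
    fix i
    have "norm (A $ i) \<le> (\<Sum>j\<in>UNIV. \<bar>A $ i $ j\<bar>)" by (rule norm_le_l1_cart)
    also have "\<dots> \<le> (\<Sum>j\<in>(UNIV::'n set). c)" using entry by (rule sum_mono)
    finally show "norm (A $ i) \<le> real CARD('n) * c" by simp
  qed
  finally show ?thesis by simp
qed

text \<open>\<open>matrix_inv\<close> is a chosen two-sided inverse, so its defining property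
  becomes available only after injectivity has given invertibility.\<close>

lemma matrix_inv_mult:
  fixes A :: "real^'n^'n"
  assumes "inj ((*v) A)"
  shows "A *v (matrix_inv A *v w) = w"
proof -
  have "invertible A"
    using assms by (simp add: invertible_left_inverse matrix_left_invertible_injective)
  then have "\<exists>B. A ** B = mat 1 \<and> B ** A = mat 1" by (simp add: invertible_def)
  then have "A ** matrix_inv A = mat 1" unfolding matrix_inv_def by (rule someI_ex[THEN conjunct1])
  then show ?thesis by (simp add: matrix_vector_mul_assoc)
qed

lemma linear_eq_sum_axis:
  fixes L :: "real^'n \<Rightarrow> 'b::real_vector"
  assumes "linear L"
  shows "L v = (\<Sum>k\<in>UNIV. v $ k *\<^sub>R L (axis k 1))"
proof -
  have "L v = L (\<Sum>k\<in>UNIV. v $ k *\<^sub>R axis k 1)"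
    using basis_expansion[of v] by (simp add: scalar_mult_eq_scaleR)
  then show ?thesis by (simp only: linear_sum[OF assms] linear_cmul[OF assms])
qed

section \<open>The expansion theorem\<close>

text \<open>Links the componentwise double sum in \<open>gamma2\<close> to the bilinear form of the
  abstract argument.\<close>

lemma G_yy_quadratic_form:
  fixes g :: "(real^'nx) \<times> (real^'ny) \<Rightarrow> real^'ny"
  assumes "bounded_C21 g D1 D2 M"
  shows "(\<Sum>j\<in>UNIV. \<Sum>k\<in>UNIV. G_yy g \<gamma> x i j k * w $ j * w $ k) = D2 (x, \<gamma> x) (0, w) (0, w) $ i"
proof -
  interpret bounded_C21 g D1 D2 M by fact
  let ?z = "(x, \<gamma> x)"
  have "((\<lambda>y. g (x, y) $ i) has_derivative (\<lambda>w. D1 (x, y) (0, w) $ i)) (at y)" for y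
    by (rule bounded_linear.has_derivative[OF bounded_linear_vec_nth has_derivative_right_section[OF g_deriv]])
  from frechet_derivative_at[OF this]
  have inner: "frechet_derivative (\<lambda>y'. g (x, y') $ i) (at y) (axis k 1) = D1 (x, y) (0, axis k 1) $ i" for y k
    by (rule fun_cong[OF sym])
  have "((\<lambda>y. D1 (x, y) v $ i) has_derivative (\<lambda>w. D2 ?z v (0, w) $ i)) (at (\<gamma> x))" for v
    by (rule bounded_linear.has_derivative[OF bounded_linear_vec_nth has_derivative_right_section[OF D1_deriv]])
  from frechet_derivative_at[OF this]
  \<comment> \<open>The inner derivative is along index \<open>k\<close>, so \<open>k\<close> fills
    the first slot of \<open>D2\<close> and \<open>j\<close> the second.\<close>
  have G: "G_yy g \<gamma> x i j k = D2 ?z (0, axis k 1) (0, axis j 1) $ i" for j k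
    unfolding G_yy_def inner by (rule fun_cong[OF sym])
  have emb: "linear (\<lambda>w. (0, w))" by (rule linearI) auto
  have "D2 ?z (0, w) (0, w) = (\<Sum>j\<in>UNIV. w $ j *\<^sub>R D2 ?z (0, w) (0, axis j 1))"
    by (rule linear_eq_sum_axis[OF linear_compose[OF emb linear_D2_right, unfolded o_def]])
  also have "\<dots> = (\<Sum>j\<in>UNIV. w $ j *\<^sub>R (\<Sum>k\<in>UNIV. w $ k *\<^sub>R D2 ?z (0, axis k 1) (0, axis j 1)))"
    by (subst linear_eq_sum_axis[OF linear_compose[OF emb linear_D2_left, unfolded o_def]]) (rule refl)
  finally show ?thesis
    by (simp add: G sum_component sum_distrib_left mult_ac)
qed

text \<open>A Landau bound is rendered by one constant chosen before \<epsilon> and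
  \<open>x\<close>; the quantifier over \<open>x\<close> inside the eventuality expresses
  uniformity. The Sobolev versions rest on the pointwise bounds together with continuity of the
  error terms.\<close>

theorem theorem3p8:
  fixes f :: "(real^'nx) \<times> (real^'ny) \<Rightarrow> real^'nx"
    and g :: "(real^'nx) \<times> (real^'ny) \<Rightarrow> real^'ny"
    and \<gamma> :: "real^'nx \<Rightarrow> real^'ny"
    and \<Gamma> :: "nat \<Rightarrow> real^'nx \<Rightarrow> real \<Rightarrow> real^'ny"
    and \<beta> \<epsilon>\<^sub>0 :: real
    and K :: nat
  assumes K: "K \<ge> 2"
    and f_smooth: "C_class K f"
    and f_W: "W_norm K f < \<infinity>"
    and g_smooth: "C_class (Suc K) g"
    and g_W: "W_norm K (full_grad g) < \<infinity>"
    and gamma_zero: "\<And>x. g (x, \<gamma> x) = 0"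
    and beta_pos: "\<beta> > 0"
    and dissipative: "\<And>x y y'. (g (x, y) - g (x, y')) \<bullet> (y - y') \<le> - \<beta> * (norm (y - y'))\<^sup>2"
    and eps0_pos: "\<epsilon>\<^sub>0 > 0"
    and Gamma_0: "\<And>x \<epsilon>. 0 < \<epsilon> \<Longrightarrow> \<epsilon> \<le> \<epsilon>\<^sub>0 \<Longrightarrow> \<Gamma> 0 x \<epsilon> = \<gamma> x"
    and Gamma_Suc: "\<And>k x \<epsilon>. 0 < \<epsilon> \<Longrightarrow> \<epsilon> \<le> \<epsilon>\<^sub>0 \<Longrightarrow>
      g (x, \<Gamma> (Suc k) x \<epsilon>) = \<epsilon> *\<^sub>R (jacobian (\<lambda>x'. \<Gamma> k x' \<epsilon>) (at x) *v f (x, \<Gamma> k x \<epsilon>))"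
  shows "(\<exists>C. \<forall>\<^sub>F \<epsilon> in at_right 0. \<forall>x.
            norm (\<Gamma> 1 x \<epsilon> - \<gamma> x - \<epsilon> *\<^sub>R gamma1 f g \<gamma> x) \<le> C * \<epsilon>^2)
    \<and> (\<exists>C. \<forall>\<^sub>F \<epsilon> in at_right 0. \<forall>x.
            norm (jacobian (\<lambda>x'. \<Gamma> 1 x' \<epsilon>) (at x) - jacobian \<gamma> (at x)
                  - \<epsilon> *\<^sub>R jacobian (gamma1 f g \<gamma>) (at x)) \<le> C * \<epsilon>^2)
    \<and> (\<exists>C. \<forall>\<^sub>F \<epsilon> in at_right 0. \<forall>x.
            norm (\<Gamma> 2 x \<epsilon> - \<gamma> x - \<epsilon> *\<^sub>R gamma1 f g \<gamma> x - \<epsilon>^2 *\<^sub>R gamma2 f g \<gamma> x) \<le> C * \<epsilon>^3)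
    \<and> (\<exists>C. \<forall>\<^sub>F \<epsilon> in at_right 0.
            W_norm 1 (\<lambda>x. \<Gamma> 1 x \<epsilon> - \<gamma> x - \<epsilon> *\<^sub>R gamma1 f g \<gamma> x) \<le> ereal (C * \<epsilon>^2))
    \<and> (\<exists>C. \<forall>\<^sub>F \<epsilon> in at_right 0.
            W_norm 0 (\<lambda>x. \<Gamma> 2 x \<epsilon> - \<gamma> x - \<epsilon> *\<^sub>R gamma1 f g \<gamma> x - \<epsilon>^2 *\<^sub>R gamma2 f g \<gamma> x)
              \<le> ereal (C * \<epsilon>^3))"
proof -
  let ?n = "real (DIM((real^'nx) \<times> (real^'ny)))"
  let ?D1 = "\<lambda>z. frechet_derivative g (at z)"
  let ?D2 = "\<lambda>z v. frechet_derivative (\<lambda>z. frechet_derivative g (at z) v) (at z)"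
  let ?Df = "\<lambda>z. frechet_derivative f (at z)"
  \<comment> \<open>\<open>K \<ge> 2\<close> provides two derivatives of \<open>f\<close> and three
    of \<open>g\<close>, the latter for the Lipschitz bound on the second derivative of
    \<open>g\<close>.\<close>
  have f2: "C_class (Suc (Suc 0)) f" and g3: "C_class (Suc (Suc (Suc 0))) g"
    using C_class_mono[OF f_smooth] C_class_mono[OF g_smooth] K by simp_all
  have "\<exists>B. \<forall>vs z. vs \<in> basis_lists j \<longrightarrow> norm (iter_deriv f vs z) \<le> B" if "j \<le> K" for j
    using C_class_W_norm_bounded[OF f_smooth f_W that] by metis
  then obtain Bf where Bf: "\<And>j vs z. j \<le> K \<Longrightarrow> vs \<in> basis_lists j \<Longrightarrow> norm (iter_deriv f vs z) \<le> Bf j" by metis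
  have "\<exists>B. \<forall>vs z. vs \<in> basis_lists (Suc j) \<longrightarrow> norm (iter_deriv g vs z) \<le> B" if "j \<le> K" for j
    using iter_deriv_bounded_of_full_grad[OF g_smooth g_W that] by metis
  then obtain Bg where Bg: "\<And>j vs z. j \<le> K \<Longrightarrow> vs \<in> basis_lists (Suc j) \<Longrightarrow> norm (iter_deriv g vs z) \<le> Bg j" by metis
  \<comment> \<open>The element 0 secures nonnegativity. Indices up to 2 mean orders 0 to 2 for
    \<open>f\<close> and, because of the shift by the gradient, orders 1 to 3 for
    \<open>g\<close>.\<close>
  define B where "B = Max ({0} \<union> Bf ` {..2} \<union> Bg ` {..2})"
  have B0: "B \<ge> 0" and BfB: "\<And>j. j \<le> 2 \<Longrightarrow> Bf j \<le> B" and BgB: "\<And>j. j \<le> 2 \<Longrightarrow> Bg j \<le> B"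
    unfolding B_def by (rule Max_ge; simp)+
  have fB: "norm (iter_deriv f vs z) \<le> B" if "j \<le> 2" "vs \<in> basis_lists j" for j vs z
    using Bf[of j vs z] BfB[of j] that K by linarith
  have gB: "norm (iter_deriv g vs z) \<le> B" if j: "j \<in> {1, 2, 3}" and vs: "vs \<in> basis_lists j" for j vs z
  proof -
    obtain i where i: "j = Suc i" "i \<le> 2" using j by (cases j) auto
    then show ?thesis using Bg[of i vs z] BgB[of i] vs K by simp
  qed
  define M where "M = ?n^3 * B"
  note pow = le_DIM_cubed_mult[where 'a="(real^'nx) \<times> (real^'ny)", OF B0, folded M_def]
  have C21: "bounded_C21 g ?D1 ?D2 M"
    unfolding M_def using g3 B0 gB by (rule C_class_bounded_C21)
  have fe: "fast_equilibrium g ?D1 ?D2 M f ?Df \<gamma> \<beta>"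
    unfolding fast_equilibrium_def fast_equilibrium_axioms_def
  proof (intro conjI allI C21 beta_pos gamma_zero)
    show fd: "(f has_derivative ?Df z) (at z)" for z
      using f2 by (rule C_class_Suc_has_derivative)
    show "norm (f z) \<le> M" for z
      using fB[of 0 "[]" z] pow(1) by (simp add: basis_lists_0)
    show "norm (?Df z v) \<le> M * norm v" for z v
    proof (rule order_trans[OF norm_linear_le_Basis mult_right_mono[OF pow(2) norm_ge_zero]])
      show "linear (?Df z)" using fd by (rule has_derivative_linear)
      show "norm (?Df z b) \<le> B" if "b \<in> Basis" for b
        using fB[of 1 "[b]" z] that by (simp add: singleton_in_basis_lists)
    qed
    show "norm (?Df z' v - ?Df z v) \<le> M * norm (z' - z) * norm v" for z z' v
    proof (rule order_trans[OF frechet_derivative_lipschitz[OF f2]])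
      show "norm (iter_deriv f us z) \<le> B" if "us \<in> basis_lists (Suc (Suc 0))" for us z
        using fB[of 2 us z] that by (simp add: numeral_2_eq_2)
      show "?n * (?n * B) * norm (z' - z) * norm v \<le> M * norm (z' - z) * norm v"
        by (intro mult_right_mono pow norm_ge_zero)
    qed
    show "\<beta> * norm (y - y') \<le> norm (g (x, y) - g (x, y'))" for x y y'
    proof (cases "y = y'")
      case False
      \<comment> \<open>Monotonicity and Cauchy-Schwarz give the inequality with an extra factor
        \<open>norm (y - y')\<close>, which is cancelled; hence the separate case of equal
        arguments.\<close>
      have "\<beta> * norm (y - y') * norm (y - y') \<le> norm (g (x, y) - g (x, y')) * norm (y - y')"
        using dissipative[of x y y'] Cauchy_Schwarz_ineq2[of "g (x, y) - g (x, y')" "y - y'"]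
        by (simp add: power2_eq_square)
      then show ?thesis using False by simp
    qed simp
  qed
  then interpret fast_equilibrium g ?D1 ?D2 M f ?Df \<gamma> \<beta> .
  have Gy: "G_y g \<gamma> x *v w = ?D1 (x, \<gamma> x) (0, w)" for x w
    using has_derivative_right_section[OF g_deriv, of x "\<gamma> x"]
    by (simp add: G_y_def jacobian_mult differentiableI frechet_derivative_at[symmetric])
  have Gy_inv: "?D1 (x, \<gamma> x) (0, matrix_inv (G_y g \<gamma> x) *v w) = w" for x w
  proof -
    have "inj ((*v) (G_y g \<gamma> x))"
    proof (rule injI)
      fix w w' assume "G_y g \<gamma> x *v w = G_y g \<gamma> x *v w'"
      then have "?D1 (x, \<gamma> x) (0, w - w') = 0" using D1_diff[of "(x, \<gamma> x)" 0 w w'] by (simp add: Gy)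
      then show "w = w'" using D1_expanding[of "w - w'" "(x, \<gamma> x)"] beta_pos by (simp add: mult_le_0_iff)
    qed
    then show ?thesis using matrix_inv_mult Gy by metis
  qed
  have Fy: "F_y f \<gamma> x *v w = ?Df (x, \<gamma> x) (0, w)" for x w
    using has_derivative_right_section[OF f_deriv, of x "\<gamma> x"]
    by (simp add: F_y_def jacobian_mult differentiableI frechet_derivative_at[symmetric])
  have J: "jacobian y (at x) *v u = frechet_derivative y (at x) u" if "C1 y y'" for y :: "real^'nx \<Rightarrow> real^'ny" and y' x u
    using jacobian_mult differentiableI[OF C1D(1)[OF that]] by blast
  have \<gamma>1_eq: "?D1 (x, \<gamma> x) (0, gamma1 f g \<gamma> x) = d\<gamma> x (f (x, \<gamma> x))" for x
    by (simp add: gamma1_def Gy_inv J[OF C1_\<gamma>] F_fun_def)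
  note C1_g1 = C1_first_order_corrector[OF \<gamma>1_eq]
  have quad: "(\<chi> i. \<Sum>j\<in>UNIV. \<Sum>k\<in>UNIV. G_yy g \<gamma> x i j k * w $ j * w $ k) = ?D2 (x, \<gamma> x) (0, w) (0, w)" for x w
    by (simp add: vec_eq_iff G_yy_quadratic_form[OF C21])
  interpret slow_manifold g ?D1 ?D2 M f ?Df \<gamma> \<beta> "gamma1 f g \<gamma>" "gamma2 f g \<gamma>"
  proof
    show "?D1 (x, \<gamma> x) (0, gamma2 f g \<gamma> x) = d\<gamma> x (?Df (x, \<gamma> x) (0, gamma1 f g \<gamma> x))
        + frechet_derivative (gamma1 f g \<gamma>) (at x) (f (x, \<gamma> x))
        - (1/2) *\<^sub>R ?D2 (x, \<gamma> x) (0, gamma1 f g \<gamma> x) (0, gamma1 f g \<gamma> x)" for x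
      unfolding gamma2_def Gy_inv quad J[OF C1_\<gamma>] J[OF C1_g1] Fy F_fun_def ..
  qed (rule \<gamma>1_eq)
  let ?\<Gamma>' = "\<lambda>\<epsilon> x. frechet_derivative (\<lambda>x. \<Gamma> 1 x \<epsilon>) (at x)"
  \<comment> \<open>All five claims depend only on the equations of the first two iterates, which
    hold for positive \<epsilon> up to the minimum of \<open>\<epsilon>\<^sub>0\<close> and
    1.\<close>
  have ev: "\<forall>\<^sub>F \<epsilon> in at_right 0. P \<epsilon>"
    if step: "\<And>\<epsilon>. first_iterate \<epsilon> (\<lambda>x. \<Gamma> 1 x \<epsilon>) \<Longrightarrow> C1 (\<lambda>x. \<Gamma> 1 x \<epsilon>) (?\<Gamma>' \<epsilon>) \<Longrightarrow>
      (\<And>x. g (x, \<Gamma> 2 x \<epsilon>) = \<epsilon> *\<^sub>R ?\<Gamma>' \<epsilon> x (f (x, \<Gamma> 1 x \<epsilon>))) \<Longrightarrow> P \<epsilon>" for P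
  proof -
    have "P \<epsilon>" if eps: "0 < \<epsilon>" "\<epsilon> \<le> \<epsilon>\<^sub>0" "\<epsilon> \<le> 1" for \<epsilon>
    proof (rule step)
      show "first_iterate \<epsilon> (\<lambda>x. \<Gamma> 1 x \<epsilon>)"
        using eps Gamma_Suc[of \<epsilon> _ 0] Gamma_0 J[OF C1_\<gamma>] by (simp add: first_iterate_def)
      then show C1: "C1 (\<lambda>x. \<Gamma> 1 x \<epsilon>) (?\<Gamma>' \<epsilon>)" by (rule first_iterate_C1)
      show "g (x, \<Gamma> 2 x \<epsilon>) = \<epsilon> *\<^sub>R ?\<Gamma>' \<epsilon> x (f (x, \<Gamma> 1 x \<epsilon>))" for x
        using eps Gamma_Suc[of \<epsilon> x 1] J[OF C1] by (simp add: numeral_2_eq_2)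
    qed
    then show ?thesis
      using eps0_pos unfolding eventually_at_right_field by (intro exI[of _ "min \<epsilon>\<^sub>0 1"]) auto
  qed
  obtain A where A: "A \<ge> 0" "\<And>\<epsilon> \<Gamma> x. first_iterate \<epsilon> \<Gamma> \<Longrightarrow> norm (\<Gamma> x - \<gamma> x - \<epsilon> *\<^sub>R gamma1 f g \<gamma> x) \<le> A * \<epsilon>\<^sup>2"
    using first_iterate_expansion by blast
  obtain B' where B': "B' \<ge> 0" "\<And>\<epsilon> \<Gamma> \<Gamma>' x u. first_iterate \<epsilon> \<Gamma> \<Longrightarrow> C1 \<Gamma> \<Gamma>' \<Longrightarrow>
     norm (\<Gamma>' x u - d\<gamma> x u - \<epsilon> *\<^sub>R d\<gamma>1 x u) \<le> B' * \<epsilon>\<^sup>2 * norm u"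
    using first_iterate_derivative_expansion by blast
  obtain C where C: "C \<ge> 0" "\<And>\<epsilon> \<Gamma> \<Gamma>' \<Gamma>2 x. first_iterate \<epsilon> \<Gamma> \<Longrightarrow> C1 \<Gamma> \<Gamma>' \<Longrightarrow>
     (\<And>x. g (x, \<Gamma>2 x) = \<epsilon> *\<^sub>R \<Gamma>' x (f (x, \<Gamma> x))) \<Longrightarrow>
     norm (\<Gamma>2 x - \<gamma> x - \<epsilon> *\<^sub>R gamma1 f g \<gamma> x - \<epsilon>\<^sup>2 *\<^sub>R gamma2 f g \<gamma> x) \<le> C * \<epsilon>^3"
    using second_iterate_expansion by blast
  show ?thesis
  proof (intro conjI)
    show "\<exists>C. \<forall>\<^sub>F \<epsilon> in at_right 0. \<forall>x. norm (\<Gamma> 1 x \<epsilon> - \<gamma> x - \<epsilon> *\<^sub>R gamma1 f g \<gamma> x) \<le> C * \<epsilon>^2"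
      using A(2) by (intro exI[of _ A] ev allI)
    show "\<exists>C. \<forall>\<^sub>F \<epsilon> in at_right 0. \<forall>x. norm (jacobian (\<lambda>x'. \<Gamma> 1 x' \<epsilon>) (at x) - jacobian \<gamma> (at x)
        - \<epsilon> *\<^sub>R jacobian (gamma1 f g \<gamma>) (at x)) \<le> C * \<epsilon>^2"
    proof (intro exI ev allI)
      fix \<epsilon> x
      assume first: "first_iterate \<epsilon> (\<lambda>x. \<Gamma> 1 x \<epsilon>)" and \<Gamma>1: "C1 (\<lambda>x. \<Gamma> 1 x \<epsilon>) (?\<Gamma>' \<epsilon>)"
      let ?J = "jacobian (\<lambda>x'. \<Gamma> 1 x' \<epsilon>) (at x) - jacobian \<gamma> (at x) - \<epsilon> *\<^sub>R jacobian (gamma1 f g \<gamma>) (at x)"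
      have "norm (?J *v u) \<le> B' * \<epsilon>\<^sup>2 * norm u" for u
        using B'(2)[OF first \<Gamma>1, of x u]
        by (simp only: matrix_vector_mult_diff_rdistrib scaleR_matrix_vector_assoc[symmetric] J[OF \<Gamma>1] J[OF C1_\<gamma>] J[OF C1_\<gamma>1])
      then have "norm ?J \<le> real CARD('ny) * (real CARD('nx) * (B' * \<epsilon>\<^sup>2))" by (rule norm_matrix_le)
      then show "norm ?J \<le> real CARD('ny) * real CARD('nx) * B' * \<epsilon>\<^sup>2" by (simp only: mult.assoc)
    qed
    show "\<exists>C. \<forall>\<^sub>F \<epsilon> in at_right 0. \<forall>x.
        norm (\<Gamma> 2 x \<epsilon> - \<gamma> x - \<epsilon> *\<^sub>R gamma1 f g \<gamma> x - \<epsilon>^2 *\<^sub>R gamma2 f g \<gamma> x) \<le> C * \<epsilon>^3"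
    proof (intro exI ev allI)
      fix \<epsilon> x
      assume "first_iterate \<epsilon> (\<lambda>x. \<Gamma> 1 x \<epsilon>)" "C1 (\<lambda>x. \<Gamma> 1 x \<epsilon>) (?\<Gamma>' \<epsilon>)"
        "\<And>x. g (x, \<Gamma> 2 x \<epsilon>) = \<epsilon> *\<^sub>R ?\<Gamma>' \<epsilon> x (f (x, \<Gamma> 1 x \<epsilon>))"
      then show "norm (\<Gamma> 2 x \<epsilon> - \<gamma> x - \<epsilon> *\<^sub>R gamma1 f g \<gamma> x - \<epsilon>^2 *\<^sub>R gamma2 f g \<gamma> x) \<le> C * \<epsilon>^3"
        by (rule C(2))
    qed
    show "\<exists>C. \<forall>\<^sub>F \<epsilon> in at_right 0.
        W_norm 1 (\<lambda>x. \<Gamma> 1 x \<epsilon> - \<gamma> x - \<epsilon> *\<^sub>R gamma1 f g \<gamma> x) \<le> ereal (C * \<epsilon>^2)"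
    proof (intro exI ev)
      fix \<epsilon> :: real
      assume first: "first_iterate \<epsilon> (\<lambda>x. \<Gamma> 1 x \<epsilon>)" and \<Gamma>1: "C1 (\<lambda>x. \<Gamma> 1 x \<epsilon>) (?\<Gamma>' \<epsilon>)"
      \<comment> \<open>\<open>W_norm_1_le\<close> takes one constant for value and derivative, and
        the sum \<open>A + B'\<close> serves both.\<close>
      have "W_norm 1 (\<lambda>x. \<Gamma> 1 x \<epsilon> - \<gamma> x - \<epsilon> *\<^sub>R gamma1 f g \<gamma> x) \<le> ereal (real (DIM(real^'nx)) * ((A + B') * \<epsilon>\<^sup>2))"
      proof (rule W_norm_1_le)
        show "C1 (\<lambda>x. \<Gamma> 1 x \<epsilon> - \<gamma> x - \<epsilon> *\<^sub>R gamma1 f g \<gamma> x) (\<lambda>x u. ?\<Gamma>' \<epsilon> x u - d\<gamma> x u - \<epsilon> *\<^sub>R d\<gamma>1 x u)"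
          by (intro C1_diff \<Gamma>1 C1_\<gamma> C1_compose[OF C1_bounded_linear[OF bounded_linear_scaleR_right] C1_\<gamma>1])
        show "norm (\<Gamma> 1 x \<epsilon> - \<gamma> x - \<epsilon> *\<^sub>R gamma1 f g \<gamma> x) \<le> (A + B') * \<epsilon>\<^sup>2" for x
          by (rule order_trans[OF A(2)[OF first]]) (use B'(1) in \<open>simp add: mult_right_mono\<close>)
        show "norm (?\<Gamma>' \<epsilon> x u - d\<gamma> x u - \<epsilon> *\<^sub>R d\<gamma>1 x u) \<le> (A + B') * \<epsilon>\<^sup>2 * norm u" for x u
          by (rule order_trans[OF B'(2)[OF first \<Gamma>1]]) (use A(1) in \<open>simp add: mult_right_mono\<close>)
      qed
      then show "W_norm 1 (\<lambda>x. \<Gamma> 1 x \<epsilon> - \<gamma> x - \<epsilon> *\<^sub>R gamma1 f g \<gamma> x) \<le> ereal (real (DIM(real^'nx)) * (A + B') * \<epsilon>\<^sup>2)"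
        by (simp only: mult.assoc)
    qed
    show "\<exists>C. \<forall>\<^sub>F \<epsilon> in at_right 0.
        W_norm 0 (\<lambda>x. \<Gamma> 2 x \<epsilon> - \<gamma> x - \<epsilon> *\<^sub>R gamma1 f g \<gamma> x - \<epsilon>^2 *\<^sub>R gamma2 f g \<gamma> x) \<le> ereal (C * \<epsilon>^3)"
    proof (intro exI ev W_norm_0_le)
      fix \<epsilon> :: real
      assume first: "first_iterate \<epsilon> (\<lambda>x. \<Gamma> 1 x \<epsilon>)" and \<Gamma>1: "C1 (\<lambda>x. \<Gamma> 1 x \<epsilon>) (?\<Gamma>' \<epsilon>)"
        and \<Gamma>2: "\<And>x. g (x, \<Gamma> 2 x \<epsilon>) = \<epsilon> *\<^sub>R ?\<Gamma>' \<epsilon> x (f (x, \<Gamma> 1 x \<epsilon>))"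
      show "continuous_on UNIV (\<lambda>x. \<Gamma> 2 x \<epsilon> - \<gamma> x - \<epsilon> *\<^sub>R gamma1 f g \<gamma> x - \<epsilon>^2 *\<^sub>R gamma2 f g \<gamma> x)"
        using second_iterate_continuous[OF \<Gamma>1 \<Gamma>2]
        by (intro continuous_intros C1_continuous[OF C1_\<gamma>] C1_continuous[OF C1_\<gamma>1] continuous_\<gamma>2)
      show "norm (\<Gamma> 2 x \<epsilon> - \<gamma> x - \<epsilon> *\<^sub>R gamma1 f g \<gamma> x - \<epsilon>^2 *\<^sub>R gamma2 f g \<gamma> x) \<le> C * \<epsilon>^3" for x
        using first \<Gamma>1 \<Gamma>2 by (rule C(2))
    qed
  qed
qed

end
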